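(* Suppose $\Theta$ is an inner function, $\phi\in H^\infty$, and $(A^\Theta_\phi)^2=0$. If $k=\dim\big(K_\Theta\ominus\ker A^\Theta_\phi\big)$, then $A^\Theta_\phi\oplus 0_k$ is unitarily equivalent to a truncated Toeplitz operator.
   Context: $L^2=L^2(\mathbb{T},dm)$ with $m$ normalized Lebesgue measure on the unit circle $\mathbb{T}$; $H^2\subset L^2$ is the Hardy space (negative Fourier coefficients equal to $0$), $H^\infty=H^2\cap L^\infty$. An inner function is $\Theta\in H^2$ with $|\Theta|=1$ a.e. on $\mathbb{T}$. The model space is $K_\Theta=H^2\ominus\Theta H^2$, and $P_\Theta$ is the orthogonal projection of $L^2$ onto $K_\Theta$. For $\phi\in L^2$ the (possibly unbounded) truncated Toeplitz operator $A^\Theta_\phi$ is $A^\Theta_\phi f=P_\Theta(\phi f)$, defined on the dense subspace $K_\Theta\cap H^\infty$ of $K_\Theta$; it is called bounded if it extends to a bounded operator on $K_\Theta$, and the extension is denoted by the same symbol (for $\phi\in L^\infty$ it is bounded and given by the same formula on all of $K_\Theta$). A bounded operator is "unitarily equivalent to a truncated Toeplitz operator" if it is unitarily equivalent to a bounded $A^{\Theta'}_{\phi'}$ for some inner function $\Theta'$ and some $\phi'\in L^2$. $0_k$ denotes the zero operator on a Hilbert space of dimension $k$ (separable and infinite dimensional if $k=\infty$). *)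

theory Defs
  imports "HOL-Analysis.Analysis" "HOL-Library.Extended_Nat"
begin

section \<open>Complex inner product spaces\<close>

text \<open>
  The inner product is linear in its first argument. The underlying real inner product, norm and
  topology are those of \<^class>\<open>real_inner\<close>. Hilbert spaces are represented as subsets that are
  complex subspaces and \<^const>\<open>complete\<close>.
\<close>

class complex_inner = real_inner +
  fixes scaleC :: "complex \<Rightarrow> 'a \<Rightarrow> 'a" (infixr "*\<^sub>C" 75)
    and cinner :: "'a \<Rightarrow> 'a \<Rightarrow> complex"
  assumes scaleC_add_right: "c *\<^sub>C (x + y) = c *\<^sub>C x + c *\<^sub>C y"
    and scaleC_add_left: "(c + d) *\<^sub>C x = c *\<^sub>C x + d *\<^sub>C x"
    and scaleC_scaleC: "c *\<^sub>C (d *\<^sub>C x) = (c * d) *\<^sub>C x"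
    and scaleC_of_real: "complex_of_real r *\<^sub>C x = scaleR r x"
    and cinner_commute: "cinner x y = cnj (cinner y x)"
    and cinner_add_left: "cinner (x + y) z = cinner x z + cinner y z"
    and cinner_scaleC_left: "cinner (c *\<^sub>C x) y = c * cinner x y"
    and Re_cinner: "Re (cinner x y) = inner x y"

instantiation prod :: (complex_inner, complex_inner) complex_inner
begin

definition scaleC_prod :: "complex \<Rightarrow> 'a \<times> 'b \<Rightarrow> 'a \<times> 'b" where
  "scaleC_prod c x = (c *\<^sub>C fst x, c *\<^sub>C snd x)"

definition cinner_prod :: "'a \<times> 'b \<Rightarrow> 'a \<times> 'b \<Rightarrow> complex" where
  "cinner_prod x y = cinner (fst x) (fst y) + cinner (snd x) (snd y)"

instance
proof
  fix x y :: "'a \<times> 'b"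
  show "cinner x y = cnj (cinner y x)"
    unfolding cinner_prod_def complex_cnj_add
    by (simp only: cinner_commute[of "fst x"] cinner_commute[of "snd x"])
qed (auto simp: scaleC_prod_def cinner_prod_def scaleC_add_right scaleC_add_left scaleC_scaleC
    scaleC_of_real cinner_add_left cinner_scaleC_left Re_cinner inner_prod_def scaleR_prod_def
    algebra_simps)

end

definition csubspace :: "'a::complex_inner set \<Rightarrow> bool" where
  "csubspace S \<longleftrightarrow> 0 \<in> S \<and> (\<forall>x\<in>S. \<forall>y\<in>S. x + y \<in> S) \<and> (\<forall>c. \<forall>x\<in>S. c *\<^sub>C x \<in> S)"

definition orth_diff :: "'a::complex_inner set \<Rightarrow> 'a set \<Rightarrow> 'a set" (infixl "\<ominus>" 65) where
  "H \<ominus> M = {x \<in> H. \<forall>y\<in>M. cinner x y = 0}"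

definition orthonormal_basis :: "'a::complex_inner set \<Rightarrow> 'a set \<Rightarrow> bool" where
  "orthonormal_basis B H \<longleftrightarrow> B \<subseteq> H \<and> (\<forall>x\<in>B. norm x = 1) \<and>
     (\<forall>x\<in>B. \<forall>y\<in>B. x \<noteq> y \<longrightarrow> cinner x y = 0) \<and> H \<ominus> B = {0}"

text \<open>
  The Hilbert space dimension of a separable Hilbert space; the value \<open>\<infinity>\<close> stands for
  countably infinite.
\<close>

definition has_hilbert_dim :: "'a::complex_inner set \<Rightarrow> enat \<Rightarrow> bool" where
  "has_hilbert_dim H k \<longleftrightarrow> (\<exists>B. orthonormal_basis B H \<and> countable B \<and>
     k = (if finite B then enat (card B) else \<infinity>))"

definition orth_proj :: "'a::complex_inner set \<Rightarrow> 'a \<Rightarrow> 'a" where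
  "orth_proj H x = (THE y. y \<in> H \<and> (\<forall>z\<in>H. cinner (x - y) z = 0))"

text \<open>
  Operators on a subspace \<open>H\<close> are total functions of which only the values on \<open>H\<close> matter.
\<close>

definition clinear_on :: "'a::complex_inner set \<Rightarrow> ('a \<Rightarrow> 'b::complex_inner) \<Rightarrow> bool" where
  "clinear_on H A \<longleftrightarrow> (\<forall>x\<in>H. \<forall>y\<in>H. A (x + y) = A x + A y) \<and> (\<forall>c. \<forall>x\<in>H. A (c *\<^sub>C x) = c *\<^sub>C A x)"

definition bounded_operator_on :: "'a::complex_inner set \<Rightarrow> ('a \<Rightarrow> 'a) \<Rightarrow> bool" where
  "bounded_operator_on H A \<longleftrightarrow> clinear_on H A \<and> A ` H \<subseteq> H \<and> (\<exists>C. \<forall>x\<in>H. norm (A x) \<le> C * norm x)"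

definition ker_on :: "'a::complex_inner set \<Rightarrow> ('a \<Rightarrow> 'b::complex_inner) \<Rightarrow> 'a set" where
  "ker_on H A = {x \<in> H. A x = 0}"

definition unitarily_equivalent ::
  "'a::complex_inner set \<Rightarrow> ('a \<Rightarrow> 'a) \<Rightarrow> 'b::complex_inner set \<Rightarrow> ('b \<Rightarrow> 'b) \<Rightarrow> bool" where
  "unitarily_equivalent H A H' A' \<longleftrightarrow> (\<exists>U. clinear_on H U \<and> U ` H = H' \<and>
     (\<forall>x\<in>H. \<forall>y\<in>H. cinner (U x) (U y) = cinner x y) \<and> (\<forall>x\<in>H. U (A x) = A' (U x)))"


section \<open>The space \<open>L\<^sup>2\<close> of the unit circle\<close>

text \<open>
  Normalized arc length measure, as a Borel measure on \<open>\<complex>\<close> concentrated on the unit circle.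
\<close>

definition circle_measure :: "complex measure" where
  "circle_measure = distr (uniform_measure lborel {0..2 * pi}) borel cis"

definition square_integrable :: "(complex \<Rightarrow> complex) \<Rightarrow> bool" where
  "square_integrable f \<longleftrightarrow> f \<in> borel_measurable circle_measure \<and>
     integrable circle_measure (\<lambda>z. (cmod (f z))\<^sup>2)"

lemma sets_circle_measure [measurable_cong]: "sets circle_measure = sets borel"
  by (simp add: circle_measure_def)

lemma borel_measurable_cnj [measurable]: "cnj \<in> borel_measurable borel"
  by (intro borel_measurable_continuous_onI continuous_intros)

lemma borel_measurable_cnj_powi:
  "(\<lambda>z. cnj (z powi n)) \<in> borel_measurable circle_measure"
  unfolding power_int_def by measurable

lemma square_integrable_zero: "square_integrable (\<lambda>_. 0)"
  by (simp add: square_integrable_def)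

lemma square_integrable_add:
  assumes f: "square_integrable f" and g: "square_integrable g"
  shows "square_integrable (\<lambda>z. f z + g z)"
proof -
  have [measurable]: "f \<in> borel_measurable circle_measure" "g \<in> borel_measurable circle_measure"
    using f g by (auto simp: square_integrable_def)
  have "integrable circle_measure (\<lambda>z. 2 * (cmod (f z))\<^sup>2 + 2 * (cmod (g z))\<^sup>2)"
    using f g by (auto simp: square_integrable_def)
  moreover have "(cmod (f z + g z))\<^sup>2 \<le> 2 * (cmod (f z))\<^sup>2 + 2 * (cmod (g z))\<^sup>2" for z
  proof -
    have "(cmod (f z + g z))\<^sup>2 \<le> (cmod (f z) + cmod (g z))\<^sup>2"
      by (intro power_mono norm_triangle_ineq) auto
    also have "\<dots> \<le> 2 * (cmod (f z))\<^sup>2 + 2 * (cmod (g z))\<^sup>2"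
      using sum_squares_bound[of "cmod (f z)" "cmod (g z)"] by (simp add: power2_sum)
    finally show ?thesis .
  qed
  ultimately have "integrable circle_measure (\<lambda>z. (cmod (f z + g z))\<^sup>2)"
    by (elim Bochner_Integration.integrable_bound) auto
  then show ?thesis by (simp add: square_integrable_def)
qed

lemma square_integrable_scale:
  assumes "square_integrable f"
  shows "square_integrable (\<lambda>z. c * f z)"
  using assms by (auto simp: square_integrable_def norm_mult power_mult_distrib)

lemma integrable_mult_cnj:
  assumes f: "square_integrable f" and g: "square_integrable g"
  shows "integrable circle_measure (\<lambda>z. f z * cnj (g z))"
proof -
  have [measurable]: "f \<in> borel_measurable circle_measure" "g \<in> borel_measurable circle_measure"
    using f g by (auto simp: square_integrable_def)
  have "integrable circle_measure (\<lambda>z. (cmod (f z))\<^sup>2 + (cmod (g z))\<^sup>2)"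
    using f g by (auto simp: square_integrable_def)
  moreover have "cmod (f z * cnj (g z)) \<le> (cmod (f z))\<^sup>2 + (cmod (g z))\<^sup>2" for z
  proof -
    have "2 * (cmod (f z) * cmod (g z)) \<le> (cmod (f z))\<^sup>2 + (cmod (g z))\<^sup>2"
      using sum_squares_bound[of "cmod (f z)" "cmod (g z)"] by simp
    moreover have "0 \<le> cmod (f z) * cmod (g z)" by simp
    ultimately show ?thesis unfolding norm_mult complex_mod_cnj by linarith
  qed
  moreover have "(\<lambda>z. f z * cnj (g z)) \<in> borel_measurable circle_measure"
    by measurable
  ultimately show ?thesis
    by (elim Bochner_Integration.integrable_bound) auto
qed

definition ae_equal :: "(complex \<Rightarrow> complex) \<Rightarrow> (complex \<Rightarrow> complex) \<Rightarrow> bool" where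
  "ae_equal f g \<longleftrightarrow> square_integrable f \<and> square_integrable g \<and> (AE z in circle_measure. f z = g z)"

lemma part_equivp_ae_equal: "part_equivp ae_equal"
proof (rule part_equivpI)
  show "\<exists>f. ae_equal f f"
    by (rule exI[of _ "\<lambda>_. 0"]) (simp add: ae_equal_def square_integrable_zero)
  show "symp ae_equal"
    by (rule sympI) (auto simp: ae_equal_def elim: AE_mp)
  show "transp ae_equal"
  proof (rule transpI)
    fix f g h assume "ae_equal f g" "ae_equal g h"
    then show "ae_equal f h" unfolding ae_equal_def by auto
  qed
qed

quotient_type L2 = "complex \<Rightarrow> complex" / partial: ae_equal
  by (rule part_equivp_ae_equal)

instantiation L2 :: complex_inner
begin

lift_definition zero_L2 :: L2 is "\<lambda>_. 0"
  by (simp add: ae_equal_def square_integrable_zero)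

lift_definition plus_L2 :: "L2 \<Rightarrow> L2 \<Rightarrow> L2" is "\<lambda>f g z. f z + g z"
  by (auto simp: ae_equal_def intro: square_integrable_add)

lift_definition scaleC_L2 :: "complex \<Rightarrow> L2 \<Rightarrow> L2" is "\<lambda>c f z. c * f z"
  by (auto simp: ae_equal_def intro: square_integrable_scale)

definition uminus_L2 :: "L2 \<Rightarrow> L2" where "uminus_L2 f = (-1) *\<^sub>C f"

definition minus_L2 :: "L2 \<Rightarrow> L2 \<Rightarrow> L2" where "minus_L2 f g = f + (- g)"

definition scaleR_L2 :: "real \<Rightarrow> L2 \<Rightarrow> L2" where "scaleR_L2 r f = complex_of_real r *\<^sub>C f"

lift_definition cinner_L2 :: "L2 \<Rightarrow> L2 \<Rightarrow> complex"
  is "\<lambda>f g. \<integral>z. f z * cnj (g z) \<partial>circle_measure"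
proof -
  fix f f' g g' assume *: "ae_equal f f'" "ae_equal g g'"
  then have "integrable circle_measure (\<lambda>z. f z * cnj (g z))"
    "integrable circle_measure (\<lambda>z. f' z * cnj (g' z))"
    by (auto simp: ae_equal_def intro: integrable_mult_cnj)
  then show "(\<integral>z. f z * cnj (g z) \<partial>circle_measure) = (\<integral>z. f' z * cnj (g' z) \<partial>circle_measure)"
    using * by (intro integral_cong_AE) (auto simp: ae_equal_def)
qed

definition inner_L2 :: "L2 \<Rightarrow> L2 \<Rightarrow> real" where "inner_L2 f g = Re (cinner f g)"

definition norm_L2 :: "L2 \<Rightarrow> real" where "norm_L2 f = sqrt (inner f f)"

definition sgn_L2 :: "L2 \<Rightarrow> L2" where "sgn_L2 f = scaleR (inverse (norm f)) f"

definition dist_L2 :: "L2 \<Rightarrow> L2 \<Rightarrow> real" where "dist_L2 f g = norm (f - g)"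

definition uniformity_L2 :: "(L2 \<times> L2) filter" where
  "uniformity_L2 = (INF e\<in>{0<..}. principal {(x, y). dist x y < e})"

definition open_L2 :: "L2 set \<Rightarrow> bool" where
  "open_L2 S = (\<forall>x\<in>S. \<forall>\<^sub>F (x', y) in uniformity. x' = x \<longrightarrow> y \<in> S)"

instance
proof
  fix f g h :: L2 and c d :: complex and r s :: real
  show assoc: "f + g + h = f + (g + h)"
    by transfer (auto simp: ae_equal_def add.assoc intro: square_integrable_add)
  show "f + g = g + f"
    by transfer (auto simp: ae_equal_def add.commute intro: square_integrable_add)
  show "0 + f = f"
    by transfer (auto simp: ae_equal_def)
  show "- f + f = 0"
    unfolding uminus_L2_def by transfer (auto simp: ae_equal_def square_integrable_zero)
  show "f - g = f + - g" by (rule minus_L2_def)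
  show scaleC_add_right': "c *\<^sub>C (f + g) = c *\<^sub>C f + c *\<^sub>C g" for c and f g :: L2
    by transfer (auto simp: ae_equal_def ring_distribs intro: square_integrable_add square_integrable_scale)
  show scaleC_add_left': "(c + d) *\<^sub>C f = c *\<^sub>C f + d *\<^sub>C f" for c d and f :: L2
    by transfer (auto simp: ae_equal_def ring_distribs intro!: square_integrable_add square_integrable_scale
        square_integrable_scale[of _ "_ + _", unfolded ring_distribs])
  show scaleC_scaleC': "c *\<^sub>C d *\<^sub>C f = (c * d) *\<^sub>C f" for c d and f :: L2
    by transfer (auto simp: ae_equal_def mult.assoc intro!: square_integrable_scale)
  have one: "1 *\<^sub>C f = f" by transfer (auto simp: ae_equal_def)
  show "complex_of_real r *\<^sub>C f = scaleR r f" by (simp add: scaleR_L2_def)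
  show "scaleR r (f + g) = scaleR r f + scaleR r g"
    by (simp add: scaleR_L2_def scaleC_add_right')
  show "scaleR (r + s) f = scaleR r f + scaleR s f"
    by (simp add: scaleR_L2_def scaleC_add_left')
  show "scaleR r (scaleR s f) = scaleR (r * s) f"
    by (simp add: scaleR_L2_def scaleC_scaleC')
  show "scaleR 1 f = f" by (simp add: scaleR_L2_def one)
  show "sgn f = scaleR (inverse (norm f)) f" by (rule sgn_L2_def)
  show "dist f g = norm (f - g)" by (rule dist_L2_def)
  show "uniformity = (INF e\<in>{0<..}. principal {(x::L2, y). dist x y < e})"
    by (rule uniformity_L2_def)
  show "open S = (\<forall>x\<in>S. \<forall>\<^sub>F (x', y) in uniformity. x' = x \<longrightarrow> y \<in> S)" for S :: "L2 set"
    by (rule open_L2_def)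
  show comm: "cinner f g = cnj (cinner g f)" for f g :: L2
    by transfer (simp flip: Bochner_Integration.integral_cnj add: mult.commute)
  show add_left: "cinner (f + g) h = cinner f h + cinner g h" for f g h :: L2
  proof (transfer, goal_cases)
    case (1 f g h)
    then have "integrable circle_measure (\<lambda>z. f z * cnj (h z))"
      "integrable circle_measure (\<lambda>z. g z * cnj (h z))"
      by (auto simp: ae_equal_def intro: integrable_mult_cnj)
    then show ?case by (simp add: ring_distribs)
  qed
  show scale_left: "cinner (c *\<^sub>C f) g = c * cinner f g" for c and f g :: L2
    by transfer (simp add: mult.assoc)
  show "Re (cinner f g) = inner f g" by (simp add: inner_L2_def)
  show "inner f g = inner g f" by (simp add: inner_L2_def comm[of f g])
  show "inner (f + g) h = inner f h + inner g h" by (simp add: inner_L2_def add_left)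
  show "inner (scaleR r f) g = r * inner f g"
    by (simp add: inner_L2_def scaleR_L2_def scale_left)
  show "norm f = sqrt (inner f f)" by (rule norm_L2_def)
  have sq: "Re (\<integral>z. F z * cnj (F z) \<partial>circle_measure) = (\<integral>z. (cmod (F z))\<^sup>2 \<partial>circle_measure)"
    for F :: "complex \<Rightarrow> complex"
  proof -
    have "(\<lambda>z. F z * cnj (F z)) = (\<lambda>z. complex_of_real ((cmod (F z))\<^sup>2))"
      by (simp only: complex_norm_square)
    then show ?thesis by (simp only: integral_complex_of_real Re_complex_of_real)
  qed
  show "0 \<le> inner f f"
    unfolding inner_L2_def by transfer (simp add: sq)
  show "inner f f = 0 \<longleftrightarrow> f = 0"
    unfolding inner_L2_def
  proof (transfer, goal_cases)
    case (1 F)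
    then have F: "square_integrable F" by (simp add: ae_equal_def)
    then have "(\<integral>z. (cmod (F z))\<^sup>2 \<partial>circle_measure) = 0 \<longleftrightarrow> (AE z in circle_measure. (cmod (F z))\<^sup>2 = 0)"
      by (intro integral_nonneg_eq_0_iff_AE) (auto simp: square_integrable_def)
    then show ?case using F by (simp add: sq ae_equal_def square_integrable_zero)
  qed
qed

end

text \<open>
  The pointwise product, where this is again square integrable, and \<open>0\<close> otherwise. The product is
  used below only when one of the factors is essentially bounded.
\<close>

lift_definition L2_mult :: "L2 \<Rightarrow> L2 \<Rightarrow> L2"
  is "\<lambda>f g. if square_integrable (\<lambda>z. f z * g z) then (\<lambda>z. f z * g z) else (\<lambda>_. 0)"
proof -
  fix f f' g g' assume *: "ae_equal f f'" "ae_equal g g'"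
  then have [measurable]: "f \<in> borel_measurable circle_measure" "f' \<in> borel_measurable circle_measure"
    "g \<in> borel_measurable circle_measure" "g' \<in> borel_measurable circle_measure"
    by (auto simp: ae_equal_def square_integrable_def)
  have ae: "AE z in circle_measure. f z * g z = f' z * g' z"
    using * by (auto simp: ae_equal_def)
  then have "integrable circle_measure (\<lambda>z. (cmod (f z * g z))\<^sup>2) \<longleftrightarrow>
    integrable circle_measure (\<lambda>z. (cmod (f' z * g' z))\<^sup>2)"
    by (intro integrable_cong_AE) auto
  then have "square_integrable (\<lambda>z. f z * g z) \<longleftrightarrow> square_integrable (\<lambda>z. f' z * g' z)"
    by (simp add: square_integrable_def)
  then show "ae_equal (if square_integrable (\<lambda>z. f z * g z) then \<lambda>z. f z * g z else (\<lambda>_. 0))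
    (if square_integrable (\<lambda>z. f' z * g' z) then \<lambda>z. f' z * g' z else (\<lambda>_. 0))"
    using ae by (simp add: ae_equal_def square_integrable_zero)
qed

lift_definition fourier_coeff :: "L2 \<Rightarrow> int \<Rightarrow> complex"
  is "\<lambda>f n. \<integral>z. f z * cnj (z powi n) \<partial>circle_measure"
proof (rule ext)
  fix f g :: "complex \<Rightarrow> complex" and n :: int
  assume "ae_equal f g"
  moreover from this have [measurable]: "f \<in> borel_measurable circle_measure"
    "g \<in> borel_measurable circle_measure"
    by (auto simp: ae_equal_def square_integrable_def)
  moreover have [measurable]: "(\<lambda>z::complex. cnj (z powi n)) \<in> borel_measurable circle_measure"
    by (rule borel_measurable_cnj_powi)
  ultimately show "(\<integral>z. f z * cnj (z powi n) \<partial>circle_measure) = (\<integral>z. g z * cnj (z powi n) \<partial>circle_measure)"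
    by (intro integral_cong_AE) (auto simp: ae_equal_def)
qed

lift_definition essentially_bounded :: "L2 \<Rightarrow> bool"
  is "\<lambda>f. \<exists>C. AE z in circle_measure. cmod (f z) \<le> C"
proof -
  fix f g assume "ae_equal f g"
  then have "AE z in circle_measure. f z = g z" by (simp add: ae_equal_def)
  then have "(AE z in circle_measure. cmod (f z) \<le> C) \<longleftrightarrow> (AE z in circle_measure. cmod (g z) \<le> C)" for C
    by auto
  then show "(\<exists>C. AE z in circle_measure. cmod (f z) \<le> C) \<longleftrightarrow> (\<exists>C. AE z in circle_measure. cmod (g z) \<le> C)"
    by simp
qed

lift_definition unimodular :: "L2 \<Rightarrow> bool"
  is "\<lambda>f. AE z in circle_measure. cmod (f z) = 1"
proof -
  fix f g assume "ae_equal f g"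
  then have "AE z in circle_measure. f z = g z" by (simp add: ae_equal_def)
  then show "(AE z in circle_measure. cmod (f z) = 1) \<longleftrightarrow> (AE z in circle_measure. cmod (g z) = 1)"
    by auto
qed


section \<open>Model spaces and truncated Toeplitz operators\<close>

definition hardy2 :: "L2 set" where
  "hardy2 = {f. \<forall>n<0. fourier_coeff f n = 0}"

definition hardy_inf :: "L2 set" where
  "hardy_inf = {f \<in> hardy2. essentially_bounded f}"

definition inner_function :: "L2 \<Rightarrow> bool" where
  "inner_function \<Theta> \<longleftrightarrow> \<Theta> \<in> hardy2 \<and> unimodular \<Theta>"

definition model_space :: "L2 \<Rightarrow> L2 set" where
  "model_space \<Theta> = hardy2 \<ominus> (L2_mult \<Theta> ` hardy2)"

text \<open>
  The formula \<open>f \<mapsto> P\<^sub>\<Theta> (\<phi> f)\<close>. For general \<open>\<phi>\<close> it is meaningful on \<open>K\<^sub>\<Theta> \<inter> H\<^sup>\<infinity>\<close>, for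
  essentially bounded \<open>\<phi>\<close> on all of \<open>K\<^sub>\<Theta>\<close>.
\<close>

definition TTO :: "L2 \<Rightarrow> L2 \<Rightarrow> L2 \<Rightarrow> L2" where
  "TTO \<Theta> \<phi> f = orth_proj (model_space \<Theta>) (L2_mult \<phi> f)"

definition bounded_TTO :: "L2 \<Rightarrow> L2 \<Rightarrow> (L2 \<Rightarrow> L2) \<Rightarrow> bool" where
  "bounded_TTO \<Theta> \<phi> A \<longleftrightarrow> bounded_operator_on (model_space \<Theta>) A \<and>
     (\<forall>f \<in> model_space \<Theta> \<inter> hardy_inf. A f = TTO \<Theta> \<phi> f)"

definition unitarily_equivalent_to_TTO :: "'a::complex_inner set \<Rightarrow> ('a \<Rightarrow> 'a) \<Rightarrow> bool" where
  "unitarily_equivalent_to_TTO H A \<longleftrightarrow> (\<exists>\<Theta> \<phi> B. inner_function \<Theta> \<and> bounded_TTO \<Theta> \<phi> B \<and>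
     unitarily_equivalent H A (model_space \<Theta>) B)"

end

theory Submission
  imports Defs
begin

text \<open>
  The set \<open>M = {f \<in> H\<^sup>2. \<phi> f \<in> \<Theta> H\<^sup>2}\<close> is a closed shift-invariant subspace of \<open>H\<^sup>2\<close> containing
  \<open>\<Theta>\<close>, so \<open>M = w H\<^sup>2\<close> with \<open>w\<close> inner, by Beurling's theorem. Writing \<open>A\<close> for the operator
  \<open>f \<mapsto> P\<^sub>\<Theta> (\<phi> f)\<close>, one finds \<open>ker A = K\<^sub>\<Theta> \<inter> w H\<^sup>2\<close> and \<open>K\<^sub>\<Theta> \<ominus> ker A = K\<^sub>w\<close>, and
  \<open>A\<^sup>2 = 0\<close> says that \<open>A\<close> maps into \<open>w H\<^sup>2\<close>. Put \<open>\<Theta>' = w \<Theta>\<close> and \<open>\<phi>' = w \<phi>\<close>, let \<open>P\<close> be the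
  projection onto \<open>K\<^sub>w\<close> and \<open>V : E \<rightarrow> K\<^sub>w\<close> unitary. Then
  \<open>U (f, e) = P f + w (f - P f) + w (V e)\<close> maps \<open>K\<^sub>\<Theta> \<oplus> E\<close> unitarily onto
  \<open>K\<^sub>\<Theta>\<^sub>' = K\<^sub>w \<oplus> w K\<^sub>\<Theta>\<close>, and it intertwines \<open>A \<oplus> 0\<close> with the truncated Toeplitz operator of
  symbol \<open>\<phi>'\<close>, since both send \<open>(f, e)\<close> to \<open>w (A f)\<close>.
\<close>

section \<open>Complex inner product spaces\<close>

text \<open>The factor w in the symbol makes the new operator vanish on multiples of w: if m lies in
  M = w H^2, then \<phi> m lies in \<Theta> H^2 and w \<phi> m in w \<Theta> H^2, whose projection
  is 0. On the other summand K_w it sends f to w (A f), because w carries K_\<Theta> into the new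
  model space and \<Theta> H^2 into w \<Theta> H^2. Now w K_\<Theta> is the orthogonal sum of w K_w
  and w (ker A), and the range only meets w (ker A). So w K_w is surplus kernel of dimension dim K_w
  = k: this is the origin of the summand 0_k. Without A^2 = 0, some A f would have a component in
  K_w, which U does not multiply by w, and intertwining would fail.

  For \<phi> nonzero, w is \<Theta> divided by its greatest common inner divisor with \<phi>;
  obtaining it from M avoids inner-outer factorization. Beurling's theorem derives |w| = 1 from the
  Fourier coefficients of |w|^2, which is known only to be integrable. This is why uniqueness of
  Fourier coefficients is proved for L^1 functions rather than through Parseval's identity.\<close>

lemma scaleC_one [simp]: "1 *\<^sub>C x = (x::'a::complex_inner)"
  using scaleC_of_real[of 1 x] by simp

lemma scaleC_zero_left [simp]: "0 *\<^sub>C x = (0::'a::complex_inner)"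
  using scaleC_of_real[of 0 x] by simp

lemma scaleC_minus_one: "(-1) *\<^sub>C x = - (x::'a::complex_inner)"
  using scaleC_of_real[of "-1" x] by simp

lemma scaleC_zero_right [simp]: "c *\<^sub>C (0::'a::complex_inner) = 0"
  by (metis scaleC_scaleC scaleC_zero_left mult_zero_right)

lemma cinner_add_right: "cinner x (y + z) = cinner x y + cinner x (z::'a::complex_inner)"
  by (metis cinner_add_left cinner_commute complex_cnj_add)

lemma cinner_scaleC_right: "cinner x (c *\<^sub>C y) = cnj c * cinner x (y::'a::complex_inner)"
  by (metis cinner_commute cinner_scaleC_left complex_cnj_mult)

lemma cinner_zero_left [simp]: "cinner 0 (y::'a::complex_inner) = 0"
  using cinner_scaleC_left[of 0 0 y] by simp

lemma cinner_zero_right [simp]: "cinner (y::'a::complex_inner) 0 = 0"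
  using cinner_scaleC_right[of y 0 0] by simp

lemma cinner_minus_left: "cinner (- x) y = - cinner x (y::'a::complex_inner)"
  using cinner_scaleC_left[of "-1" x y] by (simp add: scaleC_minus_one)

lemma cinner_diff_left: "cinner (x - y) z = cinner x z - cinner y (z::'a::complex_inner)"
  using cinner_add_left[of x "- y" z] by (simp add: cinner_minus_left)

lemma cinner_diff_right: "cinner x (y - z) = cinner x y - cinner x (z::'a::complex_inner)"
  by (metis cinner_diff_left cinner_commute complex_cnj_diff)

lemma cinner_self: "cinner x x = complex_of_real ((norm (x::'a::complex_inner))\<^sup>2)"
proof -
  have "Im (cinner x x) = 0"
    using arg_cong[OF cinner_commute[of x x], of Im] by simp
  then show ?thesis
    by (simp add: complex_eq_iff Re_cinner power2_norm_eq_inner)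
qed

lemma cinner_self_eq_0_iff [simp]: "cinner x x = 0 \<longleftrightarrow> (x::'a::complex_inner) = 0"
  by (simp add: cinner_self)

lemma cinner_eq_0_commute: "cinner x y = 0 \<longleftrightarrow> cinner y (x::'a::complex_inner) = 0"
  by (metis cinner_commute complex_cnj_zero)

text \<open>Transfers continuity from the real inner product to the complex one. The second
  component is the imaginary part because Re (-i z) = Im z.\<close>

lemma cinner_eq_Complex: "cinner x y = Complex (inner x y) (inner x (\<i> *\<^sub>C (y::'a::complex_inner)))"
  by (simp add: complex_eq_iff cinner_scaleC_right flip: Re_cinner)

lemma continuous_on_cinner_left [continuous_intros]:
  "continuous_on S (\<lambda>x. cinner (f x) (y::'a::complex_inner))" if "continuous_on S f"
  unfolding cinner_eq_Complex using that by (auto intro!: continuous_intros)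

lemma csubspaceD:
  assumes "csubspace S"
  shows "0 \<in> S" "x \<in> S \<Longrightarrow> y \<in> S \<Longrightarrow> x + y \<in> S" "x \<in> S \<Longrightarrow> c *\<^sub>C x \<in> S"
    "x \<in> S \<Longrightarrow> - x \<in> S" "x \<in> S \<Longrightarrow> y \<in> S \<Longrightarrow> x - y \<in> S"
    "x \<in> S \<Longrightarrow> r *\<^sub>R x \<in> S"
proof -
  show *: "0 \<in> S" "x \<in> S \<Longrightarrow> y \<in> S \<Longrightarrow> x + y \<in> S" "x \<in> S \<Longrightarrow> c *\<^sub>C x \<in> S" for x y c
    using assms by (auto simp: csubspace_def)
  show m: "x \<in> S \<Longrightarrow> - x \<in> S" for x
    using *(3)[of x "-1"] by (simp add: scaleC_minus_one)
  show "x \<in> S \<Longrightarrow> y \<in> S \<Longrightarrow> x - y \<in> S" for x y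
    using *(2)[of x "- y"] m by simp
  show "x \<in> S \<Longrightarrow> r *\<^sub>R x \<in> S"
    using *(3)[of x "of_real r"] by (simp add: scaleC_of_real)
qed

lemma clinear_onD:
  assumes "csubspace S" and "clinear_on S A"
  shows "x \<in> S \<Longrightarrow> y \<in> S \<Longrightarrow> A (x + y) = A x + A y" "x \<in> S \<Longrightarrow> A (c *\<^sub>C x) = c *\<^sub>C A x"
    "A 0 = 0"
proof -
  show "x \<in> S \<Longrightarrow> y \<in> S \<Longrightarrow> A (x + y) = A x + A y" "x \<in> S \<Longrightarrow> A (c *\<^sub>C x) = c *\<^sub>C A x" for x y c
    using assms(2) by (auto simp: clinear_on_def)
  from this(2)[of 0 0] show "A 0 = 0"
    using csubspaceD(1)[OF assms(1)] by simp
qed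

lemma csubspace_image:
  assumes S: "csubspace S" and A: "clinear_on S A"
  shows "csubspace (A ` S)"
  unfolding csubspace_def
proof (intro conjI ballI allI)
  show "0 \<in> A ` S" using csubspaceD(1)[OF S] clinear_onD(3)[OF S A] by (auto simp: image_iff)
next
  fix x y assume "x \<in> A ` S" "y \<in> A ` S"
  then obtain a b where "x = A a" "y = A b" "a \<in> S" "b \<in> S" by blast
  then show "x + y \<in> A ` S"
    using csubspaceD(2)[OF S] clinear_onD(1)[OF S A] by (metis imageI)
next
  fix c x assume "x \<in> A ` S"
  then obtain a where "x = A a" "a \<in> S" by blast
  then show "c *\<^sub>C x \<in> A ` S"
    using csubspaceD(3)[OF S] clinear_onD(2)[OF S A] by (metis imageI)
qed

section \<open>Orthogonal complements and orthogonal projections\<close>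

lemma csubspace_orth_diff: "csubspace H \<Longrightarrow> csubspace (H \<ominus> M)"
  by (auto simp: csubspace_def orth_diff_def cinner_add_left cinner_scaleC_left)

lemma closed_orth_diff:
  assumes "closed H" shows "closed (H \<ominus> M)"
proof -
  have "H \<ominus> M = H \<inter> (\<Inter>y\<in>M. {x. cinner x y = 0})"
    by (auto simp: orth_diff_def)
  moreover have "closed {x. cinner x y = 0}" for y :: 'a
    by (intro closed_Collect_eq continuous_intros)
  ultimately show ?thesis using assms by (auto intro!: closed_Int closed_INT)
qed

text \<open>Minimizing sequences for the distance to \<open>S\<close> are Cauchy by the parallelogram law.\<close>

lemma orth_proj_ex:
  fixes S :: "'a::complex_inner set"
  assumes S: "csubspace S" and "complete S"
  shows "\<exists>y\<in>S. \<forall>z\<in>S. cinner (x - y) z = 0"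
proof -
  define d where "d = infdist x S"
  have ne: "S \<noteq> {}" using csubspaceD(1)[OF S] by auto
  have dle: "d \<le> norm (x - y)" if "y \<in> S" for y
    unfolding d_def using infdist_le[OF that, of x] by (simp add: dist_norm)
  have d0: "0 \<le> d" by (simp add: d_def infdist_nonneg)
  have "\<exists>y\<in>S. (norm (x - y))\<^sup>2 < d\<^sup>2 + 1 / Suc n" for n
  proof -
    have "d < sqrt (d\<^sup>2 + 1 / Suc n)" by (rule real_less_rsqrt) simp
    then obtain y where "y \<in> S" "dist x y < sqrt (d\<^sup>2 + 1 / Suc n)"
      using ne cInf_lessD[of "dist x ` S"] unfolding d_def infdist_notempty[OF ne] by blast
    then have "(norm (x - y))\<^sup>2 < (sqrt (d\<^sup>2 + 1 / Suc n))\<^sup>2"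
      unfolding dist_norm by (intro power_strict_mono) auto
    then show ?thesis using \<open>y \<in> S\<close> by (auto simp: add_nonneg_nonneg)
  qed
  then obtain y where yS: "\<And>n. y n \<in> S" and y: "\<And>n. (norm (x - y n))\<^sup>2 < d\<^sup>2 + 1 / Suc n"
    by metis
  have par: "(norm (y m - y n))\<^sup>2 \<le> 2 / Suc m + 2 / Suc n" for m n
  proof -
    have "(1/2) *\<^sub>R (y m + y n) \<in> S" using yS S by (auto intro!: csubspaceD)
    then have "d\<^sup>2 \<le> (norm (x - (1/2) *\<^sub>R (y m + y n)))\<^sup>2"
      using dle d0 by (intro power_mono) auto
    also have "(norm (x - (1/2) *\<^sub>R (y m + y n)))\<^sup>2 =
        (norm (x - y m))\<^sup>2 / 2 + (norm (x - y n))\<^sup>2 / 2 - (norm (y m - y n))\<^sup>2 / 4"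
      unfolding power2_norm_eq_inner
      by (simp add: inner_diff_left inner_diff_right inner_add_left inner_add_right inner_commute
          field_simps)
    finally show ?thesis using y[of m] y[of n] by linarith
  qed
  have "Cauchy y"
  proof (rule metric_CauchyI)
    fix e :: real assume "0 < e"
    then obtain N where N: "1 / real (Suc N) < e\<^sup>2 / 4"
      using nat_approx_posE[of "e\<^sup>2 / 4"] by auto
    have "dist (y m) (y n) < e" if "m \<ge> N" "n \<ge> N" for m n
    proof -
      have "1 / real (Suc m) \<le> 1 / real (Suc N)" "1 / real (Suc n) \<le> 1 / real (Suc N)"
        using that by (auto simp: frac_le)
      then have "(norm (y m - y n))\<^sup>2 < e\<^sup>2" using par[of m n] N by auto
      then show ?thesis using \<open>0 < e\<close> by (simp add: dist_norm power2_less_imp_less)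
    qed
    then show "\<exists>M. \<forall>m\<ge>M. \<forall>n\<ge>M. dist (y m) (y n) < e" by blast
  qed
  then obtain l where l: "l \<in> S" "y \<longlonglongrightarrow> l"
    using \<open>complete S\<close> yS unfolding complete_def by blast
  have "(\<lambda>n. (norm (x - y n))\<^sup>2) \<longlonglongrightarrow> (norm (x - l))\<^sup>2"
    using l by (intro tendsto_intros)
  moreover have "(\<lambda>n. d\<^sup>2 + 1 / Suc n) \<longlonglongrightarrow> d\<^sup>2 + 0"
    by (intro tendsto_intros LIMSEQ_Suc[OF lim_1_over_n])
  ultimately have "(norm (x - l))\<^sup>2 \<le> d\<^sup>2 + 0"
    by (rule LIMSEQ_le) (use y in \<open>blast intro: less_imp_le\<close>)
  then have ld: "(norm (x - l))\<^sup>2 \<le> d\<^sup>2" by simp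
  have "cinner (x - l) z = 0" if z: "z \<in> S" for z
  proof (cases "z = 0")
    case False
    \<comment> \<open>The vector t z is the projection of x - l onto z. Moving l by t z lowers the
      squared distance by |<x - l, z>|^2 / |z|^2, so minimality of l forces this to be 0.\<close>
    define t where "t = cinner (x - l) z / cinner z z"
    have "l + t *\<^sub>C z \<in> S" using l z S by (auto intro!: csubspaceD)
    then have "d\<^sup>2 \<le> (norm (x - (l + t *\<^sub>C z)))\<^sup>2"
      using dle d0 by (intro power_mono) auto
    moreover have "cinner (x - (l + t *\<^sub>C z)) (x - (l + t *\<^sub>C z)) =
        cinner (x - l) (x - l) - cinner (x - l) z * cnj (cinner (x - l) z) / cinner z z"
    proof -
      define e where "e = x - l"
      have 1: "cinner (e - t *\<^sub>C z) z = 0"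
        using False by (simp add: cinner_diff_left cinner_scaleC_left t_def e_def)
      have "cinner (e - t *\<^sub>C z) (e - t *\<^sub>C z) = cinner (e - t *\<^sub>C z) e"
        by (subst cinner_diff_right) (simp add: cinner_scaleC_right 1)
      also have "\<dots> = cinner e e - t * cinner z e"
        by (simp add: cinner_diff_left cinner_scaleC_left)
      also have "cinner z e = cnj (cinner e z)" by (rule cinner_commute)
      finally show ?thesis by (simp add: t_def e_def diff_diff_eq)
    qed
    moreover have "cinner (x - l) z * cnj (cinner (x - l) z) / cinner z z =
      of_real ((cmod (cinner (x - l) z))\<^sup>2 / (norm z)\<^sup>2)"
      by (simp add: cinner_self complex_norm_square[symmetric] del: of_real_power)
    ultimately have "d\<^sup>2 \<le> (norm (x - (l + t *\<^sub>C z)))\<^sup>2"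
      and "complex_of_real ((norm (x - (l + t *\<^sub>C z)))\<^sup>2) =
        complex_of_real ((norm (x - l))\<^sup>2 - (cmod (cinner (x - l) z))\<^sup>2 / (norm z)\<^sup>2)"
      unfolding cinner_self by (simp_all only: of_real_diff)
    then have "(cmod (cinner (x - l) z))\<^sup>2 / (norm z)\<^sup>2 \<le> 0"
      using ld unfolding of_real_eq_iff by linarith
    then show ?thesis using False by (simp add: divide_le_0_iff)
  qed simp
  then show ?thesis using l by blast
qed

lemma orth_proj_eqI:
  assumes S: "csubspace S" and "y \<in> S" and "\<And>z. z \<in> S \<Longrightarrow> cinner (x - y) z = 0"
  shows "orth_proj S x = y"
  unfolding orth_proj_def
proof (rule the_equality)
  fix y' assume y': "y' \<in> S \<and> (\<forall>z\<in>S. cinner (x - y') z = 0)"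
  then have d: "y' - y \<in> S" using csubspaceD(5)[OF S] assms(2) by blast
  have "cinner (y' - y) (y' - y) = cinner (x - y) (y' - y) - cinner (x - y') (y' - y)"
    by (simp add: cinner_diff_left)
  then show "y' = y" using y' assms(3)[OF d] d by auto
qed (use assms in auto)

lemma orth_proj:
  assumes "csubspace S" "complete S"
  shows orth_proj_in: "orth_proj S x \<in> S"
    and orth_proj_orth: "z \<in> S \<Longrightarrow> cinner (x - orth_proj S x) z = 0"
proof -
  obtain y where "y \<in> S" "\<And>z. z \<in> S \<Longrightarrow> cinner (x - y) z = 0"
    using orth_proj_ex[OF assms] by blast
  moreover from this have "orth_proj S x = y" by (rule orth_proj_eqI[OF assms(1)])
  ultimately show "orth_proj S x \<in> S" "z \<in> S \<Longrightarrow> cinner (x - orth_proj S x) z = 0" by auto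
qed

text \<open>The residual of projecting an element of H onto S lies in the orthogonal complement,
  hence vanishes. This replaces density arguments throughout.\<close>

lemma eq_if_orth_diff_trivial:
  assumes "csubspace S" "complete S" "S \<subseteq> H" "csubspace H" "H \<ominus> S \<subseteq> {0}"
  shows "S = H"
proof -
  have "x \<in> S" if "x \<in> H" for x
  proof -
    have "x - orth_proj S x \<in> H \<ominus> S"
      unfolding orth_diff_def mem_Collect_eq
    proof (intro conjI ballI)
      show "x - orth_proj S x \<in> H"
        using assms(3) orth_proj_in[OF assms(1,2)] by (intro csubspaceD(5)[OF assms(4)] that) auto
    qed (rule orth_proj_orth[OF assms(1,2)])
    then show ?thesis using assms(5) orth_proj_in[OF assms(1,2), of x] by auto
  qed
  then show ?thesis using assms(3) by auto
qed

section \<open>Completeness of products and images; unitaries between spaces of equal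
  dimension\<close>

lemma csubspace_Times: "csubspace S \<Longrightarrow> csubspace T \<Longrightarrow> csubspace (S \<times> T)"
  by (auto simp: csubspace_def scaleC_prod_def zero_prod_def)

lemma complete_Times:
  fixes S :: "'a::metric_space set" and T :: "'b::metric_space set"
  assumes "complete S" and "complete T"
  shows "complete (S \<times> T)"
  unfolding complete_def
proof (intro allI impI, elim conjE)
  fix f :: "nat \<Rightarrow> 'a \<times> 'b" assume f: "\<forall>n. f n \<in> S \<times> T" "Cauchy f"
  then have f': "\<forall>n. fst (f n) \<in> S" "\<forall>n. snd (f n) \<in> T" by (auto simp: mem_Times_iff)
  obtain a where a: "a \<in> S" "(\<lambda>n. fst (f n)) \<longlonglongrightarrow> a"
    using assms(1)[unfolded complete_def, rule_format, of "\<lambda>n. fst (f n)"] f'(1) Cauchy_fst[OF f(2)]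
    by auto
  obtain b where b: "b \<in> T" "(\<lambda>n. snd (f n)) \<longlonglongrightarrow> b"
    using assms(2)[unfolded complete_def, rule_format, of "\<lambda>n. snd (f n)"] f'(2) Cauchy_snd[OF f(2)]
    by auto
  have "f \<longlonglongrightarrow> (a, b)"
    using tendsto_Pair[OF a(2) b(2)] by simp
  then show "\<exists>l\<in>S \<times> T. f \<longlonglongrightarrow> l"
    using a(1) b(1) by blast
qed

text \<open>A Cauchy sequence in the image pulls back to one in S, where it converges. The constant
  C is there for the coordinate projections of a graph, which are isometric only up to a
  factor.\<close>

lemma complete_isometric_image:
  fixes f :: "'a::metric_space \<Rightarrow> 'b::metric_space"
  assumes "complete S" and "\<And>x y. x \<in> S \<Longrightarrow> y \<in> S \<Longrightarrow> dist x y \<le> C * dist (f x) (f y)"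
    and "continuous_on S f" and "0 < C"
  shows "complete (f ` S)"
  unfolding complete_def
proof (intro allI impI, elim conjE)
  fix g assume g: "\<forall>n. g n \<in> f ` S" "Cauchy g"
  define h where "h n = inv_into S f (g n)" for n
  have h: "h n \<in> S" "g n = f (h n)" for n
    using g(1) by (auto simp: h_def inv_into_into f_inv_into_f)
  have "Cauchy h"
  proof (rule metric_CauchyI)
    fix e :: real assume "0 < e"
    then obtain N where N: "\<And>m n. m \<ge> N \<Longrightarrow> n \<ge> N \<Longrightarrow> dist (g m) (g n) < e / C"
      using metric_CauchyD[OF g(2), of "e / C"] \<open>0 < C\<close> by (metis divide_pos_pos)
    have "dist (h m) (h n) < e" if "m \<ge> N" "n \<ge> N" for m n
    proof -
      have "C * dist (g m) (g n) < e" using N[OF that] \<open>0 < C\<close> by (simp add: field_simps)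
      then show ?thesis using assms(2)[OF h(1) h(1), of m n] unfolding h(2) by linarith
    qed
    then show "\<exists>M. \<forall>m\<ge>M. \<forall>n\<ge>M. dist (h m) (h n) < e" by blast
  qed
  then obtain l where l: "l \<in> S" "h \<longlonglongrightarrow> l"
    using assms(1)[unfolded complete_def, rule_format, of h] h(1) by auto
  have "(\<lambda>n. f (h n)) \<longlonglongrightarrow> f l"
    by (rule continuous_on_tendsto_compose[OF assms(3) l(2,1)]) (simp add: h(1))
  then have "g \<longlonglongrightarrow> f l" by (simp flip: h(2))
  then show "\<exists>l\<in>f ` S. g \<longlonglongrightarrow> l" using l(1) by blast
qed

text \<open>
  The unitary operator matching two orthonormal bases is obtained through its graph, the closed
  span of the pairs of corresponding basis vectors; this avoids infinite sums.
\<close>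

lemma unitary_of_orthonormal_bases:
  fixes E :: "'a::complex_inner set" and K :: "'b::complex_inner set"
  assumes E: "csubspace E" "complete E" and K: "csubspace K" "complete K"
    and B: "orthonormal_basis B E" and B': "orthonormal_basis B' K" and \<sigma>: "bij_betw \<sigma> B B'"
  shows "\<exists>V. clinear_on E V \<and> V ` E = K \<and> (\<forall>x\<in>E. \<forall>y\<in>E. cinner (V x) (V y) = cinner x y)"
proof -
  define S where "S = (\<lambda>b. (b, \<sigma> b)) ` B"
  define G where "G = \<Inter>{T. csubspace T \<and> closed T \<and> S \<subseteq> T}"
  have Gsub: "G \<subseteq> T" if "csubspace T" "closed T" "S \<subseteq> T" for T
    using that by (auto simp: G_def)
  have SG: "S \<subseteq> G" by (auto simp: G_def)
  have Gc: "csubspace G" by (auto simp: G_def csubspace_def)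
  have Gcl: "closed G" by (auto simp: G_def)
  have "S \<subseteq> E \<times> K"
    using B B' \<sigma> by (auto simp: S_def orthonormal_basis_def bij_betw_def)
  then have GEK: "G \<subseteq> E \<times> K"
    by (intro Gsub csubspace_Times closed_Times complete_imp_closed E K)
  have "complete G"
    using Gcl GEK complete_closed_subset complete_Times E(2) K(2) by metis
  \<comment> \<open>Says that the inner product of p and q is the same in both coordinates. For
    fixed q this is a closed linear condition on p, so it passes from S to its closed span
    G.\<close>
  define Q :: "'a \<times> 'b \<Rightarrow> 'a \<times> 'b \<Rightarrow> bool"
    where "Q p q \<longleftrightarrow> cinner (fst p) (fst q) = cinner (snd p) (snd q)" for p q
  have Q_csubspace: "csubspace {p. Q p q}" for q
    by (auto simp: csubspace_def Q_def cinner_add_left scaleC_prod_def cinner_scaleC_left)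
  have Q_closed: "closed {p. Q p q}" for q
    unfolding Q_def by (intro closed_Collect_eq continuous_intros)
  have Q_commute: "Q p q \<longleftrightarrow> Q q p" for p q
    unfolding Q_def by (metis cinner_commute)
  have QS: "Q p q" if pq: "p \<in> S" "q \<in> S" for p q
  proof -
    obtain b c where *: "p = (b, \<sigma> b)" "q = (c, \<sigma> c)" "b \<in> B" "c \<in> B"
      using pq by (auto simp: S_def)
    then have **: "\<sigma> b \<in> B'" "\<sigma> c \<in> B'" "\<sigma> b = \<sigma> c \<longleftrightarrow> b = c"
      using \<sigma> by (auto simp: bij_betw_def inj_on_def)
    show ?thesis
    proof (cases "b = c")
      case True
      then show ?thesis using * ** B B' by (simp add: Q_def orthonormal_basis_def cinner_self)
    next
      case False
      then show ?thesis using * ** B B' by (simp add: Q_def orthonormal_basis_def)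
    qed
  qed
  \<comment> \<open>The extension from S to G is done in one argument at a time, with symmetry of Q
    in between.\<close>
  have GS: "G \<subseteq> {p. Q p q}" if "q \<in> S" for q
    using QS that by (intro Gsub Q_csubspace Q_closed) blast
  have "S \<subseteq> {p. Q p q}" if "q \<in> G" for q
    using GS that Q_commute by blast
  then have "G \<subseteq> {p. Q p q}" if "q \<in> G" for q
    using that by (intro Gsub Q_csubspace Q_closed) blast
  then have QG: "Q p q" if "p \<in> G" "q \<in> G" for p q
    using that by blast
  have iso: "cinner x x' = cinner y y'" if "(x, y) \<in> G" "(x', y') \<in> G" for x y x' y'
    using QG[OF that] by (simp add: Q_def)
  have nrm: "norm x = norm y" if "(x, y) \<in> G" for x y
    using iso[OF that that] by (simp add: cinner_self flip: of_real_power)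
  \<comment> \<open>On G both coordinates of p - q have the same norm, and the distance in the
    product is at most the sum of the two, hence the factor 2.\<close>
  have dst: "dist p q \<le> 2 * dist (fst p) (fst q) \<and> dist p q \<le> 2 * dist (snd p) (snd q)"
    if "p \<in> G" "q \<in> G" for p q
  proof -
    have "p - q \<in> G" using that by (rule csubspaceD(5)[OF Gc])
    then have "norm (fst p - fst q) = norm (snd p - snd q)"
      by (intro nrm) (simp add: minus_prod_def)
    moreover have "dist p q \<le> dist (fst p) (fst q) + dist (snd p) (snd q)"
      by (simp add: dist_prod_def sqrt_sum_squares_le_sum)
    ultimately show ?thesis by (simp add: dist_norm)
  qed
  have "complete (fst ` G)" "complete (snd ` G)"
    using \<open>complete G\<close> dst by (auto intro!: complete_isometric_image[where C = 2] continuous_intros)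
  moreover have "csubspace (fst ` G)" "csubspace (snd ` G)"
    by (intro csubspace_image[OF Gc]; simp add: clinear_on_def scaleC_prod_def)+
  moreover have "E \<ominus> fst ` G \<subseteq> {0}"
  proof -
    have "B \<subseteq> fst ` G" using SG by (force simp: S_def)
    then have "E \<ominus> fst ` G \<subseteq> E \<ominus> B" by (auto simp: orth_diff_def)
    then show ?thesis using B by (simp add: orthonormal_basis_def)
  qed
  moreover have "K \<ominus> snd ` G \<subseteq> {0}"
  proof -
    have "B' \<subseteq> snd ` G" using SG \<sigma> by (force simp: S_def bij_betw_def)
    then have "K \<ominus> snd ` G \<subseteq> K \<ominus> B'" by (auto simp: orth_diff_def)
    then show ?thesis using B' by (simp add: orthonormal_basis_def)
  qed
  ultimately have fE: "fst ` G = E" and sK: "snd ` G = K"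
    using GEK
    by (intro eq_if_orth_diff_trivial[OF _ _ _ E(1)] eq_if_orth_diff_trivial[OF _ _ _ K(1)]; force)+
  \<comment> \<open>The difference (0, y - y') lies in G, and members of G have coordinates of equal
    norm.\<close>
  have uniq: "y = y'" if "(x, y) \<in> G" "(x, y') \<in> G" for x y y'
    using nrm[of 0 "y - y'"] csubspaceD(5)[OF Gc that] by (simp add: minus_prod_def)
  define V where "V x = (SOME y. (x, y) \<in> G)" for x
  have VG: "(x, V x) \<in> G" if "x \<in> E" for x
    unfolding V_def using that fE by (intro someI_ex[of "\<lambda>y. (x, y) \<in> G"]) force
  have VI: "V x = y" if "(x, y) \<in> G" for x y
  proof -
    have "x \<in> fst ` G" using that by (rule image_eqI[rotated]) simp
    then show ?thesis using VG[of x] uniq that unfolding fE by blast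
  qed
  have "clinear_on E V"
    unfolding clinear_on_def
  proof (intro conjI ballI allI)
    fix x y assume "x \<in> E" "y \<in> E"
    then show "V (x + y) = V x + V y"
      using csubspaceD(2)[OF Gc VG VG, of x y] by (intro VI) simp
  next
    fix c x assume "x \<in> E"
    then show "V (c *\<^sub>C x) = c *\<^sub>C V x"
      using csubspaceD(3)[OF Gc VG, of x c] by (intro VI) (simp add: scaleC_prod_def)
  qed
  moreover have "V ` E = K"
  proof
    show "V ` E \<subseteq> K" using VG GEK by auto
    show "K \<subseteq> V ` E"
    proof
      fix y assume "y \<in> K"
      then obtain x where xy: "(x, y) \<in> G" using sK by force
      then have "x \<in> E" "V x = y" using GEK VI by auto
      then show "y \<in> V ` E" by blast
    qed
  qed
  moreover have "cinner (V x) (V y) = cinner x y" if "x \<in> E" "y \<in> E" for x y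
    using iso[OF VG VG] that by simp
  ultimately show ?thesis by (intro exI[of _ V] conjI ballI)
qed

lemma unitary_of_hilbert_dim:
  fixes E :: "'a::complex_inner set" and K :: "'b::complex_inner set"
  assumes "csubspace E" "complete E" "csubspace K" "complete K"
    and "has_hilbert_dim E k" "has_hilbert_dim K k"
  shows "\<exists>V. clinear_on E V \<and> V ` E = K \<and> (\<forall>x\<in>E. \<forall>y\<in>E. cinner (V x) (V y) = cinner x y)"
proof -
  obtain B where B: "orthonormal_basis B E" "countable B" "k = (if finite B then enat (card B) else \<infinity>)"
    using assms(5) by (auto simp: has_hilbert_dim_def)
  obtain B' where B': "orthonormal_basis B' K" "countable B'"
    "k = (if finite B' then enat (card B') else \<infinity>)"
    using assms(6) by (auto simp: has_hilbert_dim_def)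
  obtain \<sigma> where \<sigma>: "bij_betw \<sigma> B B'"
  proof (cases "finite B")
    case True
    then have "finite B'" "card B = card B'" using B(3) B'(3) by (auto split: if_splits)
    then show ?thesis using True finite_same_card_bij that by blast
  next
    case False
    then have "infinite B'" using B(3) B'(3) by (auto split: if_splits)
    then have "bij_betw (from_nat_into B' \<circ> to_nat_on B) B B'"
      using False B(2) B'(2) bij_betw_trans[OF to_nat_on_infinite bij_betw_from_nat_into] by blast
    then show ?thesis by (rule that)
  qed
  show ?thesis by (rule unitary_of_orthonormal_bases[OF assms(1-4) B(1) B'(1) \<sigma>])
qed

section \<open>Uniqueness of Fourier coefficients\<close>

lemma space_circle_measure [simp]: "space circle_measure = UNIV"
  by (simp add: circle_measure_def)

lemma borel_measurable_circle_measure [simp]: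
  "borel_measurable circle_measure = borel_measurable borel"
  by (rule measurable_cong_sets) (simp_all add: sets_circle_measure)

lemma emeasure_circle_measure_UNIV: "emeasure circle_measure UNIV = 1"
proof -
  have [measurable]: "cis \<in> borel_measurable borel"
    by (intro borel_measurable_continuous_onI continuous_intros)
  have "emeasure circle_measure UNIV = emeasure (uniform_measure lborel {0..2 * pi}) UNIV"
    unfolding circle_measure_def by (subst emeasure_distr) auto
  also have "\<dots> = 1"
    by (subst emeasure_uniform_measure) (auto simp: ennreal_divide_self)
  finally show ?thesis .
qed

interpretation circle: finite_measure circle_measure
  by standard (simp add: emeasure_circle_measure_UNIV)

lemma measure_circle_measure_UNIV [simp]: "measure circle_measure UNIV = 1"
  by (simp add: measure_def emeasure_circle_measure_UNIV)

lemma AE_circle_measure: "AE z in circle_measure. cmod z = 1"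
proof -
  have [measurable]: "cis \<in> borel_measurable borel"
    by (intro borel_measurable_continuous_onI continuous_intros)
  show ?thesis
    unfolding circle_measure_def by (subst AE_distr_iff) auto
qed

lemma integrable_circle_mult_bounded:
  fixes f g :: "complex \<Rightarrow> complex"
  assumes "integrable circle_measure f" and [measurable]: "g \<in> borel_measurable borel"
    and "AE z in circle_measure. cmod (g z) \<le> C"
  shows "integrable circle_measure (\<lambda>z. f z * g z)"
proof (rule Bochner_Integration.integrable_bound)
  have [measurable]: "f \<in> borel_measurable borel"
    using borel_measurable_integrable[OF assms(1)] by simp
  show "integrable circle_measure (\<lambda>z. C * cmod (f z))" using assms(1) by auto
  show "(\<lambda>z. f z * g z) \<in> borel_measurable circle_measure" by simp
  show "AE z in circle_measure. norm (f z * g z) \<le> norm (C * cmod (f z))"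
    using assms(3)
  proof eventually_elim
    case (elim z)
    then have "cmod (f z) * cmod (g z) \<le> cmod (f z) * \<bar>C\<bar>"
      by (intro mult_left_mono) auto
    then show ?case by (simp add: norm_mult abs_mult mult.commute)
  qed
qed

text \<open>
  Unlike the vanishing of a single coefficient, the vanishing of all of them is inherited by products
  with the coordinates of \<open>z\<close>, hence by products with polynomials in these. By Stone-Weierstrass
  such a function is then orthogonal to all continuous functions.
\<close>

definition fourier_null :: "(complex \<Rightarrow> complex) \<Rightarrow> bool" where
  "fourier_null h \<longleftrightarrow> integrable circle_measure h \<and>
    (\<forall>n. (\<integral>z. h z * cnj (z powi n) \<partial>circle_measure) = 0)"

lemma borel_measurable_powi [measurable]: "(\<lambda>z::complex. z powi n) \<in> borel_measurable borel"
  unfolding power_int_def by measurable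

lemma cmod_powi_circle: "cmod z = 1 \<Longrightarrow> cmod (z powi n) = 1"
  by (simp add: norm_power_int)

lemma AE_cmod_powi: "AE z in circle_measure. cmod (z powi n) \<le> 1"
  using AE_circle_measure by eventually_elim (simp add: cmod_powi_circle)

lemma cnj_powi_circle: "cmod z = 1 \<Longrightarrow> cnj z powi n = z powi (- n)"
proof -
  assume "cmod z = 1"
  then have "cnj z = inverse z" by (simp add: inverse_eq_divide divide_conv_cnj)
  then show ?thesis by (simp add: power_int_minus power_int_inverse)
qed

lemma integrable_fourier_null:
  "fourier_null h \<Longrightarrow> integrable circle_measure (\<lambda>z. h z * cnj (z powi n))"
  unfolding fourier_null_def
  by (rule integrable_circle_mult_bounded[where C = 1])
    (use AE_cmod_powi in \<open>auto simp flip: complex_cnj_power_int\<close>)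

lemma borel_measurable_fourier_null: "fourier_null h \<Longrightarrow> h \<in> borel_measurable borel"
  using borel_measurable_integrable[of circle_measure h] by (simp add: fourier_null_def)

lemma fourier_null_add: "fourier_null g \<Longrightarrow> fourier_null h \<Longrightarrow> fourier_null (\<lambda>z. g z + h z)"
  using integrable_fourier_null[of g] integrable_fourier_null[of h]
  by (auto simp: fourier_null_def ring_distribs)

lemma fourier_null_scale: "fourier_null h \<Longrightarrow> fourier_null (\<lambda>z. c * h z)"
  by (auto simp: fourier_null_def mult.assoc)

text \<open>On the circle, the coefficient of index n of h z^m is the coefficient of index n - m of
  h.\<close>

lemma fourier_null_powi:
  assumes "fourier_null h"
  shows "fourier_null (\<lambda>z. h z * z powi m)"
proof -
  have h: "h \<in> borel_measurable borel"
    using assms by (rule borel_measurable_fourier_null)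
  note [measurable] = h
  have "(\<integral>z. h z * z powi m * cnj (z powi n) \<partial>circle_measure) =
    (\<integral>z. h z * cnj (z powi (n - m)) \<partial>circle_measure)" for n
  proof (rule integral_cong_AE)
    show "AE z in circle_measure. h z * z powi m * cnj (z powi n) = h z * cnj (z powi (n - m))"
      using AE_circle_measure
    proof eventually_elim
      case (elim z)
      then have "z \<noteq> 0" by auto
      then have "z powi m * z powi (- n) = z powi (m - n)"
        by (simp flip: power_int_add)
      then show ?case using elim by (simp add: cnj_powi_circle mult.assoc)
    qed
  qed simp_all
  moreover have "integrable circle_measure (\<lambda>z. h z * z powi m)"
    using assms AE_cmod_powi unfolding fourier_null_def
    by (intro integrable_circle_mult_bounded[where C = 1]) auto
  ultimately show ?thesis using assms by (auto simp: fourier_null_def)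
qed

text \<open>A real linear form is Re ((a - ib) z), and on the circle the conjugate of z is z^(-1);
  so it is a combination of the powers 1 and -1.\<close>

lemma fourier_null_Re_Im:
  assumes "fourier_null h"
  shows "fourier_null (\<lambda>z. h z * complex_of_real (a * Re z + b * Im z))"
proof -
  have [measurable]: "h \<in> borel_measurable borel"
    using assms by (rule borel_measurable_fourier_null)
  have eq: "complex_of_real (a * Re z + b * Im z) = (Complex a (- b) * z + Complex a b * cnj z) / 2" for z
    by (simp add: complex_eq_iff)
  have "fourier_null (\<lambda>z. Complex a (- b) / 2 * (h z * z powi 1) + Complex a b / 2 * (h z * z powi (-1)))"
    using assms by (intro fourier_null_add fourier_null_scale fourier_null_powi)
  moreover have ae: "AE z in circle_measure. Complex a (- b) / 2 * (h z * z powi 1) + Complex a b / 2 * (h z * z powi (-1))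
    = h z * complex_of_real (a * Re z + b * Im z)"
    using AE_circle_measure
  proof eventually_elim
    case (elim z)
    then show ?case using cnj_powi_circle[OF elim, of 1] unfolding eq by (simp add: field_simps)
  qed
  moreover have "integrable circle_measure (\<lambda>z. h z * complex_of_real (a * Re z + b * Im z))"
    using calculation integrable_cong_AE[THEN iffD1, OF _ _ ae]
    by (auto simp: fourier_null_def)
  moreover have "(\<integral>z. (Complex a (- b) / 2 * (h z * z powi 1) + Complex a b / 2 * (h z * z powi (-1))) * cnj (z powi n) \<partial>circle_measure)
    = (\<integral>z. h z * complex_of_real (a * Re z + b * Im z) * cnj (z powi n) \<partial>circle_measure)" for n
    by (rule integral_cong_AE) (use ae in auto)
  ultimately show ?thesis by (simp add: fourier_null_def)
qed

lemma fourier_null_polynomial: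
  assumes "real_polynomial_function p" and "fourier_null h"
  shows "fourier_null (\<lambda>z. h z * complex_of_real (p z))"
  using assms
proof (induction arbitrary: h)
  case (linear f)
  have "f z = f 1 * Re z + f \<i> * Im z" for z
  proof -
    have "z = Re z *\<^sub>R 1 + Im z *\<^sub>R \<i>" by (simp add: complex_eq_iff)
    then have "f z = f (Re z *\<^sub>R 1 + Im z *\<^sub>R \<i>)" by (rule arg_cong)
    also have "\<dots> = Re z *\<^sub>R f 1 + Im z *\<^sub>R f \<i>"
      by (simp only: linear_add linear_scale bounded_linear.linear[OF linear(1)])
    finally show ?thesis by simp
  qed
  then obtain a b where f: "f = (\<lambda>z. a * Re z + b * Im z)" by blast
  show ?case unfolding f by (rule fourier_null_Re_Im[OF linear(2)])
next
  case (const c)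
  then show ?case using fourier_null_scale[of h "complex_of_real c"] by (simp add: mult.commute)
next
  case (add f g)
  from fourier_null_add[OF add.IH(1)[OF add.prems] add.IH(2)[OF add.prems]]
  show ?case by (simp add: ring_distribs)
next
  \<comment> \<open>The second factor is applied to h times the first one, which is why h is
    generalized in the induction.\<close>
  case (mult f g)
  from mult.IH(2)[OF mult.IH(1)[OF mult.prems]] show ?case by (simp add: mult.assoc)
qed

lemma fourier_null_continuous:
  fixes f :: "complex \<Rightarrow> real"
  assumes h: "fourier_null h" and f: "continuous_on UNIV f"
  shows "(\<integral>z. h z * complex_of_real (f z) \<partial>circle_measure) = 0"
proof -
  have [measurable]: "h \<in> borel_measurable borel" "f \<in> borel_measurable borel"
    using borel_measurable_fourier_null[OF h] borel_measurable_continuous_onI[OF f] by auto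
  have ih: "integrable circle_measure h" using h by (simp add: fourier_null_def)
  define I where "I = (\<integral>z. cmod (h z) \<partial>circle_measure)"
  have *: "cmod (\<integral>z. h z * complex_of_real (f z) \<partial>circle_measure) \<le> e * I" if e: "0 < e" for e
  proof -
    obtain p where p: "real_polynomial_function p" "\<And>z. z \<in> sphere 0 1 \<Longrightarrow> \<bar>f z - p z\<bar> < e"
      by (rule Stone_Weierstrass_real_polynomial_function[OF compact_sphere[of 0 1]
          continuous_on_subset[OF f subset_UNIV] e]) blast
    have "continuous_on UNIV p"
      using continuous_on_polymonial_function real_polynomial_function_eq p(1) by metis
    then have [measurable]: "p \<in> borel_measurable borel"
      by (rule borel_measurable_continuous_onI)
    have ae: "AE z in circle_measure. cmod (complex_of_real (f z - p z)) \<le> e"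
      using AE_circle_measure
    proof eventually_elim
      case (elim z)
      then show ?case using p(2)[of z] by (simp only: norm_of_real) simp
    qed
    have i1: "integrable circle_measure (\<lambda>z. h z * complex_of_real (f z - p z))"
      by (rule integrable_circle_mult_bounded[OF ih _ ae]) simp
    have n: "fourier_null (\<lambda>z. h z * complex_of_real (p z))"
      by (rule fourier_null_polynomial[OF p(1) h])
    then have i2: "integrable circle_measure (\<lambda>z. h z * complex_of_real (p z))"
      by (simp add: fourier_null_def)
    have "(\<integral>z. h z * complex_of_real (p z) \<partial>circle_measure) = 0"
      using n by (auto simp: fourier_null_def dest: spec[of _ 0])
    then have "(\<integral>z. h z * complex_of_real (f z) \<partial>circle_measure) =
      (\<integral>z. h z * complex_of_real (f z - p z) \<partial>circle_measure)"
      using Bochner_Integration.integral_add[OF i1 i2] by (simp add: ring_distribs)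
    also have "cmod \<dots> \<le> (\<integral>z. e * cmod (h z) \<partial>circle_measure)"
    proof (rule order_trans[OF integral_norm_bound integral_mono_AE])
      show "AE z in circle_measure. cmod (h z * complex_of_real (f z - p z)) \<le> e * cmod (h z)"
        using ae
      proof eventually_elim
        case (elim z)
        then show ?case
          unfolding norm_mult by (subst mult.commute) (rule mult_right_mono, simp_all)
      qed
    qed (use i1 ih in auto)
    also have "\<dots> = e * I" by (simp add: I_def)
    finally show ?thesis .
  qed
  have "0 \<le> I" by (simp add: I_def)
  have "cmod (\<integral>z. h z * complex_of_real (f z) \<partial>circle_measure) \<le> e" if "0 < e" for e
  proof -
    \<comment> \<open>Dividing by I + 1 instead of I covers the case I = 0.\<close>
    have "cmod (\<integral>z. h z * complex_of_real (f z) \<partial>circle_measure) \<le> e / (I + 1) * I"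
      using that \<open>0 \<le> I\<close> by (intro *) simp
    also have "\<dots> \<le> e"
      using that \<open>0 \<le> I\<close> by (simp add: field_simps)
    finally show ?thesis .
  qed
  then have "cmod (\<integral>z. h z * complex_of_real (f z) \<partial>circle_measure) \<le> 0"
    by (rule field_le_epsilon[where y = 0, unfolded add_0_left])
  then show ?thesis by simp
qed

text \<open>The continuous functions \<open>f n\<close> are 1 on F and vanish at distance at least
  1/n from it (for n > 0). They tend to the indicator of F because F is closed, and |h| dominates
  the integrands.\<close>

lemma fourier_null_closed:
  assumes h: "fourier_null h" and F: "closed F"
  shows "(\<integral>z. indicator F z *\<^sub>R h z \<partial>circle_measure) = 0"
\<comment> \<open>By convention \<open>infdist\<close> to the empty set is 0, so the approximants
  would be constantly 1 there.\<close>
proof (cases "F = {}")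
  case False
  have [measurable]: "h \<in> borel_measurable borel" "F \<in> sets borel"
    using borel_measurable_fourier_null[OF h] F by auto
  have ih: "integrable circle_measure h" using h by (simp add: fourier_null_def)
  define f where "f n z = max 0 (1 - real n * infdist z F)" for n z
  have c: "continuous_on UNIV (f n)" for n
    unfolding f_def by (intro continuous_intros)
  have [measurable]: "f n \<in> borel_measurable borel" for n
    using c by (rule borel_measurable_continuous_onI)
  have lim: "(\<lambda>n. f n z) \<longlonglongrightarrow> indicator F z" for z
  proof (cases "z \<in> F")
    case True
    then show ?thesis by (simp add: f_def)
  next
    case zF: False
    then have d: "infdist z F > 0"
      using F False in_closed_iff_infdist_zero[of F z] infdist_nonneg[of z F] by linarith
    obtain N where N: "1 / infdist z F < real N" using reals_Archimedean2 by blast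
    have "f n z = 0" if "n \<ge> N" for n
    proof -
      have "1 / infdist z F < real n" using N that by linarith
      then show ?thesis using d by (simp add: f_def field_simps)
    qed
    then have "eventually (\<lambda>n. f n z = 0) sequentially"
      unfolding eventually_sequentially by blast
    then have "(\<lambda>n. f n z) \<longlonglongrightarrow> 0" by (rule tendsto_eventually)
    then show ?thesis using zF by simp
  qed
  have "(\<lambda>n. \<integral>z. h z * complex_of_real (f n z) \<partial>circle_measure) \<longlonglongrightarrow>
    (\<integral>z. h z * complex_of_real (indicator F z) \<partial>circle_measure)"
  proof (rule integral_dominated_convergence[where w = "\<lambda>z. cmod (h z)"])
    show "AE z in circle_measure. (\<lambda>n. h z * complex_of_real (f n z)) \<longlonglongrightarrow> h z * complex_of_real (indicator F z)"
      using lim by (intro AE_I2 tendsto_intros)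
    show "AE z in circle_measure. norm (h z * complex_of_real (f n z)) \<le> cmod (h z)" for n
    proof (rule AE_I2)
      fix z
      have "\<bar>f n z\<bar> \<le> 1" by (auto simp: f_def infdist_nonneg)
      then show "norm (h z * complex_of_real (f n z)) \<le> cmod (h z)"
        using mult_left_mono[of "\<bar>f n z\<bar>" 1 "cmod (h z)"] by (simp add: norm_mult)
    qed
  qed (use ih in auto)
  then have "(\<integral>z. h z * complex_of_real (indicator F z) \<partial>circle_measure) = 0"
    unfolding fourier_null_continuous[OF h c] by (simp add: LIMSEQ_const_iff)
  then show ?thesis by (simp add: scaleR_conv_of_real mult.commute)
qed simp

text \<open>Closed sets are an intersection-stable generator of the Borel sets, so the integral of h
  over every Borel set vanishes. Integrability of h suffices, which matters because the lemma is
  applied to products of two L^2 functions.\<close>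

lemma fourier_null_AE_zero:
  assumes h: "fourier_null h"
  shows "AE z in circle_measure. h z = 0"
proof (rule circle.density_zero)
  show ih: "integrable circle_measure h" using h by (simp add: fourier_null_def)
  have [measurable]: "h \<in> borel_measurable borel"
    using borel_measurable_integrable[OF ih] by simp
  fix A assume "A \<in> sets circle_measure"
  then have A: "A \<in> sigma_sets UNIV (Collect closed)"
    by (simp add: sets_circle_measure borel_eq_closed)
  have "Int_stable (Collect closed :: complex set set)" by (auto simp: Int_stable_def)
  moreover have "Collect closed \<subseteq> Pow (UNIV :: complex set)" by simp
  ultimately show "set_lebesgue_integral circle_measure A h = 0"
    using A
  proof (induction rule: sigma_sets_induct_disjoint)
    case (basic A)
    then show ?case using fourier_null_closed[OF h] by (simp add: set_lebesgue_integral_def)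
  next
    case empty
    then show ?case by (simp add: set_lebesgue_integral_def)
  next
    case (compl A)
    then have [measurable]: "A \<in> sets circle_measure"
      by (simp add: sets_circle_measure borel_eq_closed)
    have "integrable circle_measure (\<lambda>z. indicator A z *\<^sub>R h z)"
      using ih by (rule integrable_mult_indicator[rotated]) simp
    moreover have "indicator (UNIV - A) z *\<^sub>R h z = h z - indicator A z *\<^sub>R h z" for z
      by (simp add: indicator_def)
    ultimately have "set_lebesgue_integral circle_measure (UNIV - A) h =
      (\<integral>z. h z \<partial>circle_measure) - set_lebesgue_integral circle_measure A h"
      using ih by (simp add: set_lebesgue_integral_def)
    moreover have "(\<integral>z. h z \<partial>circle_measure) = 0"
      using fourier_null_closed[OF h closed_UNIV] by simp
    ultimately show ?case using compl by simp
  next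
    case (union A)
    then have [measurable]: "A i \<in> sets circle_measure" for i
      by (auto simp: sets_circle_measure borel_eq_closed)
    have "set_integrable circle_measure (\<Union>(range A)) h"
      unfolding set_integrable_def using ih by (rule integrable_mult_indicator[rotated]) auto
    then have "set_lebesgue_integral circle_measure (\<Union>(range A)) h =
      (\<Sum>i. set_lebesgue_integral circle_measure (A i) h)"
      using union by (intro lebesgue_integral_countable_add) (auto simp: disjoint_family_on_def)
    then show ?case using union by simp
  qed
qed

text \<open>In the angle t the integrand is exp (int), with antiderivative exp (int) / (in) of
  period 2 pi.\<close>

lemma circle_integral_powi:
  assumes "n \<noteq> 0"
  shows "(\<integral>z. z powi n \<partial>circle_measure) = 0"
proof -
  have [measurable]: "cis \<in> borel_measurable borel"
    by (intro borel_measurable_continuous_onI continuous_intros)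
  define f where "f t = cis (of_int n * t)" for t
  have cis_powi: "cis t powi n = f t" for t
    unfolding f_def by (simp add: cis_power_int)
  have [measurable]: "f \<in> borel_measurable borel"
    unfolding f_def by (intro borel_measurable_continuous_onI continuous_intros)
  have "((\<lambda>t. exp (\<i> * of_int n * of_real t) / (\<i> * of_int n)) has_vector_derivative f t)
      (at t within {0..2 * pi})" for t
    unfolding f_def cis_conv_exp using assms
    by (intro has_vector_derivative_real_field[where f = "\<lambda>z. exp (\<i> * of_int n * z) / (\<i> * of_int n)"])
      (auto intro!: derivative_eq_intros simp: mult.assoc)
  then have "((\<lambda>t. f t / (\<i> * of_int n)) has_vector_derivative f t) (at t within {0..2 * pi})" for t
    by (simp add: f_def cis_conv_exp mult.assoc)
  then have "(f has_integral f (2 * pi) / (\<i> * of_int n) - f 0 / (\<i> * of_int n)) {0..2 * pi}"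
    by (intro fundamental_theorem_of_calculus) auto
  then have "integral {0..2 * pi} f = 0"
    using cis_multiple_2pi[of "of_int n"] by (simp add: integral_unique f_def mult_ac)
  have dens: "uniform_measure lborel {0..2 * pi} =
      density lborel (\<lambda>t. ennreal (indicator {0..2 * pi} t / (2 * pi)))"
    unfolding uniform_measure_def
    by (intro density_cong) (auto simp: divide_ennreal ennreal_indicator[symmetric] simp flip: ennreal_1 split: split_indicator)
  have "(\<integral>z. z powi n \<partial>circle_measure) = (\<integral>t. f t \<partial>uniform_measure lborel {0..2 * pi})"
    unfolding circle_measure_def by (subst integral_distr) (auto simp: cis_powi)
  also have "\<dots> = (\<integral>t. (indicator {0..2 * pi} t / (2 * pi)) *\<^sub>R f t \<partial>lborel)"
    unfolding dens by (subst integral_density) auto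
  also have "\<dots> = (\<integral>t. (1 / (2 * pi)) *\<^sub>R (indicator {0..2 * pi} t *\<^sub>R f t) \<partial>lborel)"
    by (simp only: scaleR_scaleR times_divide_eq_left mult_1_left)
  also have "\<dots> = (1 / (2 * pi)) *\<^sub>R (LINT t : {0..2 * pi} | lborel. f t)"
    by (simp only: set_lebesgue_integral_def integral_scaleR_right)
  also have "(LINT t : {0..2 * pi} | lborel. f t) = integral {0..2 * pi} f"
    by (intro set_borel_integral_eq_integral borel_integrable_atLeastAtMost')
      (auto simp: f_def intro!: continuous_intros)
  also note \<open>integral {0..2 * pi} f = 0\<close>
  finally show ?thesis by simp
qed

section \<open>Completeness of \<open>L\<^sup>2\<close>\<close>

lemma ae_equal_self [simp]: "ae_equal F F \<longleftrightarrow> square_integrable F"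
  by (simp add: ae_equal_def)

lemma L2_cases: obtains F where "square_integrable F" and "f = abs_L2 F"
  by (induction f rule: L2.abs_induct) auto

lemma abs_L2_eq_iff:
  assumes "square_integrable F" "square_integrable G"
  shows "abs_L2 F = abs_L2 G \<longleftrightarrow> (AE z in circle_measure. F z = G z)"
  using Quotient3_rel[OF Quotient3_L2, of F G] assms by (auto simp: ae_equal_def)

lemma square_integrable_diff:
  "square_integrable F \<Longrightarrow> square_integrable G \<Longrightarrow> square_integrable (\<lambda>z. F z - G z)"
  using square_integrable_add[OF _ square_integrable_scale[of G "-1"], of F] by simp

lemma diff_abs_L2:
  assumes "square_integrable F" "square_integrable G"
  shows "abs_L2 F - abs_L2 G = abs_L2 (\<lambda>z. F z - G z)"
  unfolding minus_L2_def uminus_L2_def using assms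
  by (simp add: scaleC_L2.abs_eq plus_L2.abs_eq square_integrable_scale[of G "-1", simplified])

lemma norm_abs_L2:
  assumes "square_integrable F"
  shows "(norm (abs_L2 F))\<^sup>2 = (\<integral>z. (cmod (F z))\<^sup>2 \<partial>circle_measure)"
proof -
  have "complex_of_real ((norm (abs_L2 F))\<^sup>2) = (\<integral>z. F z * cnj (F z) \<partial>circle_measure)"
    using assms by (simp only: cinner_self[symmetric] cinner_L2.abs_eq ae_equal_self)
  also have "\<dots> = (\<integral>z. complex_of_real ((cmod (F z))\<^sup>2) \<partial>circle_measure)"
    by (simp only: complex_norm_square)
  finally show ?thesis by (simp only: integral_complex_of_real of_real_eq_iff)
qed

lemma square_integrable_borel_measurable: "square_integrable F \<Longrightarrow> F \<in> borel_measurable borel"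
  by (simp add: square_integrable_def)

section \<open>The Riesz-Fischer argument\<close>

text \<open>The sum of the increments |F (n+1) - F n| has finite integral, so it is finite almost
  everywhere and the telescoping series converges absolutely there.\<close>

lemma rapidly_Cauchy_L2_AE_convergent:
  assumes F: "\<And>n. square_integrable (F n)"
    and d: "\<And>n. (\<integral>z. (cmod (F (Suc n) z - F n z))\<^sup>2 \<partial>circle_measure) \<le> (1/4)^n"
  shows "AE z in circle_measure. convergent (\<lambda>n. F n z)"
proof -
  have [measurable]: "F n \<in> borel_measurable borel" for n
    by (rule square_integrable_borel_measurable[OF F])
  define D where "D n z = cmod (F (Suc n) z - F n z)" for n z
  have [measurable]: "D n \<in> borel_measurable borel" for n
    unfolding D_def by measurable
  have iD2: "integrable circle_measure (\<lambda>z. (D n z)\<^sup>2)" for n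
    using square_integrable_diff[OF F F, of "Suc n" n] by (simp add: square_integrable_def D_def)
  \<comment> \<open>This is t \<le> 1 + t^2 for t = 2^n D, divided by 2^n. As the total mass is 1,
    it turns the L^2 bound 4^(-n) into the L^1 bound 2 * 2^(-n) without the Cauchy-Schwarz
    inequality.\<close>
  have le: "D n z \<le> (1/2)^n + 2^n * (D n z)\<^sup>2" for n z
  proof -
    have "2 * (2^n * D n z) \<le> 1 + (2^n * D n z)\<^sup>2"
      using sum_squares_bound[of 1 "2^n * D n z"] by simp
    moreover have "0 \<le> 2^n * D n z" by (simp add: D_def)
    ultimately have "2^n * D n z \<le> 1 + (2^n * D n z)\<^sup>2" by linarith
    then have "(1/2)^n * (2^n * D n z) \<le> (1/2)^n * (1 + (2^n * D n z)\<^sup>2)"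
      by (intro mult_left_mono) auto
    then show ?thesis
      by (simp add: power_mult_distrib power_one_over field_simps power2_eq_square)
  qed
  have "(\<integral>\<^sup>+z. ennreal (D n z) \<partial>circle_measure) \<le> ennreal (2 * (1/2)^n)" for n
  proof -
    have i: "integrable circle_measure (\<lambda>z. (1/2)^n + 2^n * (D n z)\<^sup>2)"
      using iD2 by simp
    have "(\<integral>\<^sup>+z. ennreal (D n z) \<partial>circle_measure)
        \<le> (\<integral>\<^sup>+z. ennreal ((1/2)^n + 2^n * (D n z)\<^sup>2) \<partial>circle_measure)"
      by (intro nn_integral_mono ennreal_leI le)
    also have "\<dots> = ennreal (\<integral>z. (1/2)^n + 2^n * (D n z)\<^sup>2 \<partial>circle_measure)"
      by (intro nn_integral_eq_integral i) auto
    also have "(\<integral>z. (1/2)^n + 2^n * (D n z)\<^sup>2 \<partial>circle_measure) =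
        (1/2)^n + 2^n * (\<integral>z. (D n z)\<^sup>2 \<partial>circle_measure)"
      using iD2 by simp
    also have "\<dots> \<le> (1/2)^n + 2^n * (1/4)^n"
      using d[of n] by (intro add_left_mono mult_left_mono) (auto simp: D_def)
    also have "(2::real)^n * (1/4)^n = (1/2)^n"
      by (simp flip: power_mult_distrib)
    finally show ?thesis by (simp add: ennreal_leI)
  qed
  then have "(\<Sum>n. \<integral>\<^sup>+z. ennreal (D n z) \<partial>circle_measure) \<le> (\<Sum>n. ennreal (2 * (1/2)^n))"
    by (intro suminf_le) auto
  also have "\<dots> = ennreal (\<Sum>n. 2 * (1/2)^n)"
    by (intro suminf_ennreal2 summable_mult summable_geometric) auto
  finally have "(\<integral>\<^sup>+z. (\<Sum>n. ennreal (D n z)) \<partial>circle_measure) \<noteq> \<infinity>"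
    by (subst nn_integral_suminf) (auto simp: top_unique)
  then have "AE z in circle_measure. (\<Sum>n. ennreal (D n z)) \<noteq> \<infinity>"
    by (intro nn_integral_PInf_AE) auto
  then show ?thesis
  proof eventually_elim
    case (elim z)
    then have "summable (\<lambda>n. D n z)"
      by (intro summable_suminf_not_top) (auto simp: D_def)
    then have "summable (\<lambda>n. F (Suc n) z - F n z)"
      unfolding D_def by (rule summable_norm_cancel)
    then have "convergent (\<lambda>m. \<Sum>n<m. F (Suc n) z - F n z)"
      by (simp only: summable_iff_convergent)
    moreover have "(\<Sum>n<m. F (Suc n) z - F n z) = F m z - F 0 z" for m
      by (rule sum_lessThan_telescope[of "\<lambda>n. F n z"])
    ultimately have "convergent (\<lambda>n. F n z - F 0 z)" by simp
    then have "convergent (\<lambda>n. F n z - F 0 z + F 0 z)"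
      by (intro convergent_add convergent_const)
    then show ?case by simp
  qed
qed

text \<open>Fatou's lemma as m tends to infinity with n fixed. The limit G is not assumed square
  integrable; this follows later by subtracting F n - G from F n.\<close>

lemma L2_diff_le_Fatou:
  assumes F: "\<And>n. square_integrable (F n)" and [measurable]: "G \<in> borel_measurable borel"
    and lim: "AE z in circle_measure. (\<lambda>n. F n z) \<longlonglongrightarrow> G z"
    and le: "\<And>m. n \<le> m \<Longrightarrow> (\<integral>z. (cmod (F n z - F m z))\<^sup>2 \<partial>circle_measure) \<le> c"
  shows "square_integrable (\<lambda>z. F n z - G z)"
    and "(\<integral>z. (cmod (F n z - G z))\<^sup>2 \<partial>circle_measure) \<le> c"
proof -
  have [measurable]: "F n \<in> borel_measurable borel" for n
    by (rule square_integrable_borel_measurable[OF F])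
  have "0 \<le> c" using le[of n] by simp
  have "(\<integral>\<^sup>+z. ennreal ((cmod (F n z - G z))\<^sup>2) \<partial>circle_measure) =
    (\<integral>\<^sup>+z. liminf (\<lambda>m. ennreal ((cmod (F n z - F m z))\<^sup>2)) \<partial>circle_measure)"
  proof (rule nn_integral_cong_AE, use lim in eventually_elim)
    case (elim z)
    then have "(\<lambda>m. ennreal ((cmod (F n z - F m z))\<^sup>2)) \<longlonglongrightarrow> ennreal ((cmod (F n z - G z))\<^sup>2)"
      by (intro tendsto_intros)
    then show ?case by (intro lim_imp_Liminf[symmetric]) auto
  qed
  also have "\<dots> \<le> liminf (\<lambda>m. \<integral>\<^sup>+z. ennreal ((cmod (F n z - F m z))\<^sup>2) \<partial>circle_measure)"
    by (intro nn_integral_liminf) simp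
  also have "\<dots> \<le> ennreal c"
  proof (rule Liminf_le)
    show "\<forall>\<^sub>F m in sequentially. (\<integral>\<^sup>+z. ennreal ((cmod (F n z - F m z))\<^sup>2) \<partial>circle_measure) \<le> ennreal c"
      unfolding eventually_sequentially
    proof (intro exI allI impI)
      fix m assume m: "n \<le> m"
      have "(\<integral>\<^sup>+z. ennreal ((cmod (F n z - F m z))\<^sup>2) \<partial>circle_measure) =
        ennreal (\<integral>z. (cmod (F n z - F m z))\<^sup>2 \<partial>circle_measure)"
        using square_integrable_diff[OF F F, of n m]
        by (intro nn_integral_eq_integral) (auto simp: square_integrable_def)
      then show "(\<integral>\<^sup>+z. ennreal ((cmod (F n z - F m z))\<^sup>2) \<partial>circle_measure) \<le> ennreal c"
        using le[OF m] by (simp add: ennreal_leI)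
    qed
  qed simp
  finally have fin: "(\<integral>\<^sup>+z. ennreal ((cmod (F n z - G z))\<^sup>2) \<partial>circle_measure) \<le> ennreal c" .
  then have i: "integrable circle_measure (\<lambda>z. (cmod (F n z - G z))\<^sup>2)"
    by (intro integrableI_bounded) (auto simp: less_top[symmetric] top_unique)
  then show "square_integrable (\<lambda>z. F n z - G z)" by (simp add: square_integrable_def)
  show "(\<integral>z. (cmod (F n z - G z))\<^sup>2 \<partial>circle_measure) \<le> c"
    using fin \<open>0 \<le> c\<close> by (subst (asm) nn_integral_eq_integral[OF i]) auto
qed

lemma rapidly_Cauchy_L2_convergent:
  fixes X :: "nat \<Rightarrow> L2"
  assumes X: "\<And>n. norm (X (Suc n) - X n) \<le> (1/2)^n"
  shows "convergent X"
proof -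
  have "\<exists>F. square_integrable F \<and> X n = abs_L2 F" for n
    by (rule L2_cases[of "X n"]) blast
  then have "\<forall>n. \<exists>F. square_integrable F \<and> X n = abs_L2 F" by blast
  from choice[OF this] obtain F
    where F: "\<And>n. square_integrable (F n)" and XF: "\<And>n. X n = abs_L2 (F n)" by blast
  have nrm: "(norm (X n - X m))\<^sup>2 = (\<integral>z. (cmod (F n z - F m z))\<^sup>2 \<partial>circle_measure)" for n m
    unfolding XF diff_abs_L2[OF F F] by (rule norm_abs_L2[OF square_integrable_diff[OF F F]])
  have [measurable]: "F n \<in> borel_measurable borel" for n
    by (rule square_integrable_borel_measurable[OF F])
  have "(\<integral>z. (cmod (F (Suc n) z - F n z))\<^sup>2 \<partial>circle_measure) \<le> (1/4)^n" for n
  proof -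
    have "(norm (X (Suc n) - X n))\<^sup>2 \<le> ((1/2)^n)\<^sup>2" by (intro power_mono X) auto
    also have "((1/2::real)^n)\<^sup>2 = (1/4)^n"
      unfolding power2_eq_square by (simp flip: power_mult_distrib)
    finally show ?thesis by (simp add: nrm)
  qed
  then have conv: "AE z in circle_measure. convergent (\<lambda>n. F n z)"
    by (rule rapidly_Cauchy_L2_AE_convergent[OF F])
  \<comment> \<open>Where the sequence diverges, \<open>lim\<close> has one fixed value, so G is
    measurable on the whole space.\<close>
  define G where "G z = lim (\<lambda>n. F n z)" for z
  have Gm: "G \<in> borel_measurable borel"
    unfolding G_def by measurable
  have lim: "AE z in circle_measure. (\<lambda>n. F n z) \<longlonglongrightarrow> G z"
    using conv by eventually_elim (simp add: G_def convergent_LIMSEQ_iff)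
  \<comment> \<open>The bound is the geometric sum of (1/2)^i for i from n to n + k - 1, kept exact
    so that the induction closes.\<close>
  have tel: "norm (X n - X (n + k)) \<le> 2 * (1/2)^n - 2 * (1/2)^(n + k)" for n k
  proof (induction k)
    case (Suc k)
    have "norm (X n - X (n + Suc k)) \<le> norm (X n - X (n + k)) + norm (X (Suc (n + k)) - X (n + k))"
      using norm_triangle_ineq4[of "X n - X (n + k)" "X (Suc (n + k)) - X (n + k)"] by simp
    then show ?case using Suc X[of "n + k"] by simp
  qed simp
  have bd: "(\<integral>z. (cmod (F n z - F m z))\<^sup>2 \<partial>circle_measure) \<le> (2 * (1/2)^n)\<^sup>2" if "n \<le> m" for n m
  proof -
    have "0 \<le> (1/2::real)^m" by simp
    then have "norm (X n - X m) \<le> 2 * (1/2)^n"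
      using tel[of n "m - n"] unfolding le_add_diff_inverse[OF that] by linarith
    then show ?thesis
      unfolding nrm[symmetric] by (intro power_mono) auto
  qed
  have FG: "square_integrable (\<lambda>z. F n z - G z)"
    "(\<integral>z. (cmod (F n z - G z))\<^sup>2 \<partial>circle_measure) \<le> (2 * (1/2)^n)\<^sup>2" for n
    by (rule L2_diff_le_Fatou(1)[OF F Gm lim bd], assumption,
        rule L2_diff_le_Fatou(2)[OF F Gm lim bd], assumption)
  have G: "square_integrable G"
    using square_integrable_diff[OF F[of 0] FG(1)[of 0]] by simp
  have "norm (X n - abs_L2 G) \<le> 2 * (1/2)^n" for n
  proof (rule power2_le_imp_le)
    show "(norm (X n - abs_L2 G))\<^sup>2 \<le> (2 * (1/2)^n)\<^sup>2"
      unfolding XF diff_abs_L2[OF F G] norm_abs_L2[OF FG(1)[of n]] by (rule FG(2)[of n])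
  qed simp
  then have "\<forall>\<^sub>F n in sequentially. norm (X n - abs_L2 G) \<le> 2 * (1/2)^n"
    by (intro always_eventually allI)
  moreover have "(\<lambda>n. 2 * (1/2::real)^n) \<longlonglongrightarrow> 0"
    by (rule tendsto_mult_right_zero[OF LIMSEQ_power_zero]) simp
  ultimately have "(\<lambda>n. X n - abs_L2 G) \<longlonglongrightarrow> 0"
    by (rule Lim_null_comparison)
  then have "X \<longlonglongrightarrow> abs_L2 G" by (rule LIM_zero_cancel)
  then show ?thesis by (rule convergentI)
qed

text \<open>A Cauchy sequence converges as soon as a subsequence does, so it is enough to extract
  one whose increments are below (1/2)^n. Completeness makes orthogonal projections onto closed
  subspaces of \<open>L2\<close> available.\<close>

instance L2 :: complete_space
proof
  fix X :: "nat \<Rightarrow> L2" assume X: "Cauchy X"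
  have ex: "\<exists>N. \<forall>p\<ge>N. \<forall>q\<ge>N. dist (X p) (X q) < (1/2)^n" for n
    by (rule metric_CauchyD[OF X]) simp
  have "\<exists>r. \<forall>n. (\<forall>p\<ge>r n. \<forall>q\<ge>r n. dist (X p) (X q) < (1/2)^n) \<and> r n < r (Suc n)"
  proof (rule dependent_nat_choice)
    fix x n
    obtain N where "\<forall>p\<ge>N. \<forall>q\<ge>N. dist (X p) (X q) < (1/2)^Suc n" using ex by blast
    then show "\<exists>y. (\<forall>p\<ge>y. \<forall>q\<ge>y. dist (X p) (X q) < (1/2)^Suc n) \<and> x < y"
      by (intro exI[of _ "max N (Suc x)"]) auto
  qed (rule ex)
  then obtain r where r: "\<And>n p q. p \<ge> r n \<Longrightarrow> q \<ge> r n \<Longrightarrow> dist (X p) (X q) < (1/2)^n"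
    and mono: "\<And>n. r n < r (Suc n)" by blast
  have "norm ((X \<circ> r) (Suc n) - (X \<circ> r) n) \<le> (1/2)^n" for n
    using r[of n "r (Suc n)" "r n"] mono[of n] by (simp add: dist_norm)
  then have "convergent (X \<circ> r)" by (rule rapidly_Cauchy_L2_convergent)
  then show "convergent X"
    using Cauchy_converges_subseq[OF X, of r] mono
    by (auto simp: convergent_def strict_mono_Suc_iff)
qed

section \<open>Multiplication operators\<close>

lemma closed_imp_complete_L2: "closed S \<Longrightarrow> complete (S :: L2 set)"
  using complete_eq_closed by blast

lemma square_integrable_mult_bounded:
  assumes A: "square_integrable A" "AE z in circle_measure. cmod (A z) \<le> C" and F: "square_integrable F"
  shows "square_integrable (\<lambda>z. A z * F z)"
    and "(\<integral>z. (cmod (A z * F z))\<^sup>2 \<partial>circle_measure) \<le> C\<^sup>2 * (\<integral>z. (cmod (F z))\<^sup>2 \<partial>circle_measure)"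
proof -
  have [measurable]: "A \<in> borel_measurable borel" "F \<in> borel_measurable borel"
    using A(1) F by (auto simp: square_integrable_def)
  have i: "integrable circle_measure (\<lambda>z. C\<^sup>2 * (cmod (F z))\<^sup>2)"
    using F by (simp add: square_integrable_def)
  have ae: "AE z in circle_measure. (cmod (A z * F z))\<^sup>2 \<le> C\<^sup>2 * (cmod (F z))\<^sup>2"
    using A(2)
  proof eventually_elim
    case (elim z)
    then have "(cmod (A z))\<^sup>2 \<le> C\<^sup>2" by (intro power_mono) auto
    then show ?case by (simp add: norm_mult power_mult_distrib mult_right_mono)
  qed
  have i': "integrable circle_measure (\<lambda>z. (cmod (A z * F z))\<^sup>2)"
    by (rule Bochner_Integration.integrable_bound[OF i]) (use ae in auto)
  then show "square_integrable (\<lambda>z. A z * F z)"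
    by (simp add: square_integrable_def)
  show "(\<integral>z. (cmod (A z * F z))\<^sup>2 \<partial>circle_measure) \<le> C\<^sup>2 * (\<integral>z. (cmod (F z))\<^sup>2 \<partial>circle_measure)"
    using integral_mono_AE[OF i' i ae] by simp
qed

text \<open>With an essentially bounded factor the product is always square integrable, so the
  default 0 in \<open>L2_mult\<close> never occurs; the rules for products are read off from such
  representatives.\<close>

definition bounded_representative :: "L2 \<Rightarrow> (complex \<Rightarrow> complex) \<Rightarrow> real \<Rightarrow> bool" where
  "bounded_representative a A C \<longleftrightarrow>
    square_integrable A \<and> a = abs_L2 A \<and> (AE z in circle_measure. cmod (A z) \<le> C)"

lemma essentially_bounded_cases:
  assumes "essentially_bounded a"
  obtains A C where "bounded_representative a A C"
proof -
  obtain A where A: "square_integrable A" "a = abs_L2 A" by (rule L2_cases)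
  then show ?thesis
    using assms that by (auto simp: essentially_bounded.abs_eq bounded_representative_def)
qed

lemma bounded_representativeD:
  assumes "bounded_representative a A C"
  shows "square_integrable A" "a = abs_L2 A" "AE z in circle_measure. cmod (A z) \<le> C"
    and "square_integrable F \<Longrightarrow> square_integrable (\<lambda>z. A z * F z)"
    and "square_integrable F \<Longrightarrow> L2_mult a (abs_L2 F) = abs_L2 (\<lambda>z. A z * F z)"
    and "square_integrable F \<Longrightarrow>
      (\<integral>z. (cmod (A z * F z))\<^sup>2 \<partial>circle_measure) \<le> C\<^sup>2 * (\<integral>z. (cmod (F z))\<^sup>2 \<partial>circle_measure)"
proof -
  show A: "square_integrable A" "a = abs_L2 A" "AE z in circle_measure. cmod (A z) \<le> C"
    using assms by (auto simp: bounded_representative_def)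
  note sq = square_integrable_mult_bounded[OF A(1,3)]
  show "square_integrable F \<Longrightarrow> square_integrable (\<lambda>z. A z * F z)"
    and "square_integrable F \<Longrightarrow>
      (\<integral>z. (cmod (A z * F z))\<^sup>2 \<partial>circle_measure) \<le> C\<^sup>2 * (\<integral>z. (cmod (F z))\<^sup>2 \<partial>circle_measure)"
    by (rule sq; assumption)+
  show "square_integrable F \<Longrightarrow> L2_mult a (abs_L2 F) = abs_L2 (\<lambda>z. A z * F z)"
    using sq(1)[of F] A by (simp add: L2_mult.abs_eq)
qed

lemma L2_mult_commute: "L2_mult a b = L2_mult b a"
proof -
  obtain A where A: "square_integrable A" "a = abs_L2 A" by (rule L2_cases)
  obtain B where B: "square_integrable B" "b = abs_L2 B" by (rule L2_cases)
  show ?thesis using A B by (simp add: L2_mult.abs_eq mult.commute)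
qed

lemma L2_mult_add_right:
  assumes "essentially_bounded a"
  shows "L2_mult a (f + g) = L2_mult a f + L2_mult a g"
proof -
  obtain A C where A0: "bounded_representative a A C"
    using assms by (rule essentially_bounded_cases)
  note A = bounded_representativeD[OF A0]
  obtain F where F: "square_integrable F" "f = abs_L2 F" by (rule L2_cases)
  obtain G where G: "square_integrable G" "g = abs_L2 G" by (rule L2_cases)
  show ?thesis
    unfolding F(2) G(2) using F(1) G(1) by (simp add: plus_L2.abs_eq A(4,5) square_integrable_add ring_distribs)
qed

lemma L2_mult_scaleC_right:
  assumes "essentially_bounded a"
  shows "L2_mult a (c *\<^sub>C f) = c *\<^sub>C L2_mult a f"
proof -
  obtain A C where A0: "bounded_representative a A C"
    using assms by (rule essentially_bounded_cases)
  note A = bounded_representativeD[OF A0]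
  obtain F where F: "square_integrable F" "f = abs_L2 F" by (rule L2_cases)
  show ?thesis
    unfolding F(2) using F(1) by (simp add: scaleC_L2.abs_eq A(4,5) square_integrable_scale mult.left_commute)
qed

lemma clinear_on_L2_mult: "essentially_bounded a \<Longrightarrow> clinear_on S (L2_mult a)"
  by (simp add: clinear_on_def L2_mult_add_right L2_mult_scaleC_right)

lemma csubspace_UNIV: "csubspace UNIV"
  by (simp add: csubspace_def)

lemma L2_mult_zero_right [simp]: "L2_mult a 0 = 0"
proof -
  obtain A where A: "square_integrable A" "a = abs_L2 A" by (rule L2_cases)
  then show ?thesis by (simp add: zero_L2.abs_eq L2_mult.abs_eq square_integrable_zero)
qed

lemma L2_mult_diff_right:
  assumes "essentially_bounded a"
  shows "L2_mult a (f - g) = L2_mult a f - L2_mult a g"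
  using L2_mult_add_right[OF assms, of "f - g" g] by simp

lemma L2_mult_bounded:
  assumes "essentially_bounded a"
  obtains C where "0 \<le> C" "\<forall>f. norm (L2_mult a f) \<le> C * norm f"
proof -
  obtain A C where A0: "bounded_representative a A C"
    using assms by (rule essentially_bounded_cases)
  note A = bounded_representativeD[OF A0]
  have "norm (L2_mult a f) \<le> \<bar>C\<bar> * norm f" for f
  proof -
    obtain F where F: "square_integrable F" "f = abs_L2 F" by (rule L2_cases)
    have "(norm (L2_mult a f))\<^sup>2 \<le> (\<bar>C\<bar> * norm f)\<^sup>2"
      unfolding F(2) A(5)[OF F(1)] power_mult_distrib norm_abs_L2[OF F(1)] norm_abs_L2[OF A(4)[OF F(1)]]
      using A(6)[OF F(1)] by simp
    then show ?thesis by (rule power2_le_imp_le) simp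
  qed
  then show ?thesis by (intro that[of "\<bar>C\<bar>"]) auto
qed

lemma continuous_on_L2_mult:
  assumes "essentially_bounded a"
  shows "continuous_on S (L2_mult a)"
proof -
  obtain C where C: "0 \<le> C" "\<forall>f. norm (L2_mult a f) \<le> C * norm f"
    using assms by (rule L2_mult_bounded)
  have "C-lipschitz_on S (L2_mult a)"
    using C by (intro lipschitz_onI) (auto simp: dist_norm simp flip: L2_mult_diff_right[OF assms])
  then show ?thesis by (rule lipschitz_on_continuous_on)
qed

lemma essentially_bounded_mult:
  assumes "essentially_bounded a" "essentially_bounded b"
  shows "essentially_bounded (L2_mult a b)"
proof -
  obtain A C where A0: "bounded_representative a A C"
    using assms(1) by (rule essentially_bounded_cases)
  note A = bounded_representativeD[OF A0]
  obtain B D where B0: "bounded_representative b B D"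
    using assms(2) by (rule essentially_bounded_cases)
  note B = bounded_representativeD[OF B0]
  have "AE z in circle_measure. cmod (A z * B z) \<le> C * D"
    using A(3) B(3)
  proof eventually_elim
    case (elim z)
    then show ?case unfolding norm_mult by (intro mult_mono) (auto intro: order_trans[OF norm_ge_zero])
  qed
  then show ?thesis
    using A(4)[OF B(1)] unfolding B(2) A(5)[OF B(1)] by (auto simp: essentially_bounded.abs_eq)
qed

text \<open>Boundedness of a and b makes each intermediate product square integrable; otherwise the
  default 0 could occur on one side only.\<close>

lemma L2_mult_assoc:
  assumes "essentially_bounded a" "essentially_bounded b"
  shows "L2_mult (L2_mult a b) f = L2_mult a (L2_mult b f)"
proof -
  obtain A C where A0: "bounded_representative a A C"
    using assms(1) by (rule essentially_bounded_cases)
  note A = bounded_representativeD[OF A0]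
  obtain B D where B0: "bounded_representative b B D"
    using assms(2) by (rule essentially_bounded_cases)
  note B = bounded_representativeD[OF B0]
  obtain F where F: "square_integrable F" "f = abs_L2 F" by (rule L2_cases)
  have "square_integrable (\<lambda>z. A z * (B z * F z))" by (rule A(4)[OF B(4)[OF F(1)]])
  then have *: "square_integrable (\<lambda>z. A z * B z * F z)" by (simp add: mult.assoc)
  have "L2_mult (L2_mult a b) f = abs_L2 (\<lambda>z. A z * B z * F z)"
    using * A(4)[OF B(1)] unfolding F(2) B(2) A(5)[OF B(1)] by (simp add: L2_mult.abs_eq F(1))
  also have "\<dots> = L2_mult a (L2_mult b f)"
    unfolding F(2) B(5)[OF F(1)] A(5)[OF B(4)[OF F(1)]] by (simp add: mult.assoc)
  finally show ?thesis .
qed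

lemma L2_mult_left_commute:
  assumes "essentially_bounded a" "essentially_bounded b"
  shows "L2_mult a (L2_mult b f) = L2_mult b (L2_mult a f)"
  using L2_mult_assoc[OF assms] L2_mult_assoc[OF assms(2,1)] L2_mult_commute[of a b] by metis

section \<open>Multiplication by unimodular functions as an isometry\<close>

lemma unimodular_essentially_bounded: "unimodular a \<Longrightarrow> essentially_bounded a"
proof -
  assume "unimodular a"
  moreover obtain A where A: "square_integrable A" "a = abs_L2 A" by (rule L2_cases)
  ultimately have "AE z in circle_measure. cmod (A z) \<le> 1"
    by (auto simp: unimodular.abs_eq)
  then show ?thesis using A by (auto simp: essentially_bounded.abs_eq)
qed

lemma cinner_unimodular_mult:
  assumes a: "unimodular a"
  shows "cinner (L2_mult a f) (L2_mult a g) = cinner f g"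
proof -
  obtain A C where A0: "bounded_representative a A C"
    using unimodular_essentially_bounded[OF a] by (rule essentially_bounded_cases)
  note A = bounded_representativeD[OF A0]
  have ae: "AE z in circle_measure. cmod (A z) = 1" using a A(1) unfolding A(2) by (simp add: unimodular.abs_eq)
  obtain F where F: "square_integrable F" "f = abs_L2 F" by (rule L2_cases)
  obtain G where G: "square_integrable G" "g = abs_L2 G" by (rule L2_cases)
  have [measurable]: "A \<in> borel_measurable borel" "F \<in> borel_measurable borel" "G \<in> borel_measurable borel"
    using A(1) F(1) G(1) by (auto simp: square_integrable_def)
  have "(\<integral>z. A z * F z * cnj (A z * G z) \<partial>circle_measure) = (\<integral>z. F z * cnj (G z) \<partial>circle_measure)"
  proof (rule integral_cong_AE)
    show "AE z in circle_measure. A z * F z * cnj (A z * G z) = F z * cnj (G z)"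
      using ae
    proof eventually_elim
      case (elim z)
      have "A z * F z * cnj (A z * G z) = (A z * cnj (A z)) * (F z * cnj (G z))" by simp
      also have "A z * cnj (A z) = 1"
        unfolding complex_norm_square[symmetric] elim by simp
      finally show ?case by simp
    qed
  qed simp_all
  then show ?thesis
    unfolding F(2) G(2) using F(1) G(1) by (simp add: A(4,5) cinner_L2.abs_eq)
qed

lemma norm_unimodular_mult:
  assumes "unimodular a"
  shows "norm (L2_mult a f) = norm f"
proof -
  have "complex_of_real ((norm (L2_mult a f))\<^sup>2) = complex_of_real ((norm f)\<^sup>2)"
    unfolding cinner_self[symmetric] by (rule cinner_unimodular_mult[OF assms])
  then show ?thesis by (simp only: of_real_eq_iff) simp
qed

lemma unimodular_mult_iff:
  assumes a: "unimodular a"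
  shows "unimodular (L2_mult a b) \<longleftrightarrow> unimodular b"
proof -
  obtain A C where A0: "bounded_representative a A C"
    using unimodular_essentially_bounded[OF a] by (rule essentially_bounded_cases)
  note A = bounded_representativeD[OF A0]
  have ae: "AE z in circle_measure. cmod (A z) = 1" using a A(1) unfolding A(2) by (simp add: unimodular.abs_eq)
  obtain B where B: "square_integrable B" "b = abs_L2 B" by (rule L2_cases)
  have "AE z in circle_measure. cmod (A z * B z) = 1 \<longleftrightarrow> cmod (B z) = 1"
    using ae by eventually_elim (simp add: norm_mult)
  then have "(AE z in circle_measure. cmod (A z * B z) = 1) \<longleftrightarrow> (AE z in circle_measure. cmod (B z) = 1)"
    by (intro iffI; elim AE_mp; simp)
  then show ?thesis using B(1) A(4)[OF B(1)] unfolding B(2) A(5)[OF B(1)] by (simp add: unimodular.abs_eq)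
qed

section \<open>Fourier coefficients\<close>

lemma square_integrable_powi: "square_integrable (\<lambda>z. z powi n)"
  unfolding square_integrable_def
proof
  show "integrable circle_measure (\<lambda>z. (cmod (z powi n))\<^sup>2)"
  proof (rule circle.integrable_const_bound[where B = 1])
    show "AE z in circle_measure. norm ((cmod (z powi n))\<^sup>2) \<le> 1"
      using AE_circle_measure by eventually_elim (simp add: cmod_powi_circle)
  qed simp
qed simp

text \<open>The characters as elements of \<open>L2\<close>: Fourier coefficients become inner
  products with them, and the shift becomes multiplication by \<open>zpow 1\<close>.\<close>

lift_definition zpow :: "int \<Rightarrow> L2" is "\<lambda>n z. z powi n"
  by (simp add: square_integrable_powi)

lemma unimodular_zpow: "unimodular (zpow n)"
  using AE_circle_measure
  by (simp add: zpow.abs_eq unimodular.abs_eq square_integrable_powi)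
    (elim eventually_mono, simp add: cmod_powi_circle)

lemma fourier_coeff_eq_cinner: "fourier_coeff f n = cinner f (zpow n)"
  by transfer simp

lemma zpow_mult: "L2_mult (zpow m) (zpow n) = zpow (m + n)"
proof -
  have sq: "square_integrable (\<lambda>z. z powi m * z powi n)"
    using square_integrable_mult_bounded(1)[OF square_integrable_powi AE_cmod_powi square_integrable_powi] .
  have "AE z in circle_measure. z powi m * z powi n = z powi (m + n)"
    using AE_circle_measure
  proof eventually_elim
    case (elim z)
    then have "z \<noteq> 0" by auto
    then show ?case by (simp add: power_int_add)
  qed
  then show ?thesis
    using sq by (simp add: zpow.abs_eq L2_mult.abs_eq square_integrable_powi abs_L2_eq_iff)
qed

lemma zpow_mult_zero [simp]: "L2_mult (zpow 0) f = f"
proof -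
  obtain F where F: "square_integrable F" "f = abs_L2 F" by (rule L2_cases)
  then show ?thesis by (simp add: zpow.abs_eq L2_mult.abs_eq square_integrable_powi[of 0, simplified])
qed

lemmas zpow_bounded = unimodular_essentially_bounded[OF unimodular_zpow]

lemma zpow_mult_mult: "L2_mult (zpow m) (L2_mult (zpow n) f) = L2_mult (zpow (m + n)) f"
  using L2_mult_assoc[OF zpow_bounded zpow_bounded, of m n f] by (simp add: zpow_mult)

lemma cinner_zpow_mult: "cinner (L2_mult (zpow m) f) g = cinner f (L2_mult (zpow (- m)) g)"
  using cinner_unimodular_mult[OF unimodular_zpow, of m f "L2_mult (zpow (- m)) g"]
  by (simp add: zpow_mult_mult)

lemma cinner_zpow_zpow: "m \<noteq> n \<Longrightarrow> cinner (zpow m) (zpow n) = 0"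
proof -
  assume "m \<noteq> n"
  have "cinner (zpow m) (zpow n) = cinner (zpow (m - n)) (zpow 0)"
    using cinner_zpow_mult[of n "zpow (m - n)" "zpow n"] by (simp add: zpow_mult)
  also have "\<dots> = 0"
    using \<open>m \<noteq> n\<close> circle_integral_powi[of "m - n"]
    by (simp add: zpow.abs_eq cinner_L2.abs_eq square_integrable_powi square_integrable_powi[of 0, simplified])
  finally show ?thesis .
qed

text \<open>The inner product of f with z^n w is the Fourier coefficient of index n of f cnj(w). So
  this L^1 function vanishes, and w is nonzero almost everywhere.\<close>

lemma eq_zero_if_orth_zpow_mult_unimodular:
  assumes w: "unimodular w" and f: "\<And>n. cinner f (L2_mult (zpow n) w) = 0"
  shows "f = 0"
proof -
  obtain F where F: "square_integrable F" "f = abs_L2 F" by (rule L2_cases)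
  obtain W where W: "square_integrable W" "w = abs_L2 W" by (rule L2_cases)
  have sq: "square_integrable (\<lambda>z. z powi n * W z)" for n
    by (rule square_integrable_mult_bounded(1)[OF square_integrable_powi AE_cmod_powi W(1)])
  have "fourier_null (\<lambda>z. F z * cnj (W z))"
    unfolding fourier_null_def
  proof (intro conjI allI)
    show "integrable circle_measure (\<lambda>z. F z * cnj (W z))"
      by (rule integrable_mult_cnj[OF F(1) W(1)])
    fix n
    have "0 = (\<integral>z. F z * cnj (z powi n * W z) \<partial>circle_measure)"
      using f[of n] F W sq by (simp add: zpow.abs_eq L2_mult.abs_eq cinner_L2.abs_eq square_integrable_powi)
    then show "(\<integral>z. F z * cnj (W z) * cnj (z powi n) \<partial>circle_measure) = 0"
      by (simp add: mult_ac)
  qed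
  then have "AE z in circle_measure. F z * cnj (W z) = 0" by (rule fourier_null_AE_zero)
  moreover have "AE z in circle_measure. cmod (W z) = 1" using w W by (simp add: unimodular.abs_eq)
  ultimately have "AE z in circle_measure. F z = 0" by eventually_elim auto
  then show ?thesis
    using F by (simp add: zero_L2.abs_eq abs_L2_eq_iff square_integrable_zero)
qed

lemma eq_zero_if_orth_zpow: "(\<And>n. cinner f (zpow n) = 0) \<Longrightarrow> f = 0"
  using eq_zero_if_orth_zpow_mult_unimodular[OF unimodular_zpow[of 0], of f] by (simp add: zpow_mult)

text \<open>The inner product of w with z^n w is the Fourier coefficient of index n of |w|^2, so
  |w|^2 has the same coefficients as the constant 1.\<close>

lemma unimodular_if_orth_zpow_mult:
  assumes nrm: "norm w = 1" and orth: "\<And>n. n \<noteq> 0 \<Longrightarrow> cinner w (L2_mult (zpow n) w) = 0"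
  shows "unimodular w"
proof -
  obtain W where W: "square_integrable W" "w = abs_L2 W" by (rule L2_cases)
  have sq: "square_integrable (\<lambda>z. z powi n * W z)" for n
    by (rule square_integrable_mult_bounded(1)[OF square_integrable_powi AE_cmod_powi W(1)])
  have one: "square_integrable (\<lambda>_. 1)" using square_integrable_powi[of 0] by simp
  have "fourier_null (\<lambda>z. W z * cnj (W z) - 1)"
    unfolding fourier_null_def
  proof (intro conjI allI)
    have iW: "integrable circle_measure (\<lambda>z. W z * cnj (z powi n * W z))" for n
      by (rule integrable_mult_cnj[OF W(1) sq])
    have i1: "integrable circle_measure (\<lambda>z. 1 * cnj (z powi n))" for n
      by (rule integrable_mult_cnj[OF one square_integrable_powi])
    show "integrable circle_measure (\<lambda>z. W z * cnj (W z) - 1)"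
      using iW[of 0] i1[of 0] by simp
    fix n
    have "cinner w (L2_mult (zpow n) w) - cinner (zpow 0) (zpow n) = 0"
    proof (cases "n = 0")
      case True
      have "cinner (zpow 0) (zpow 0) = 1"
        by (simp add: zpow.abs_eq cinner_L2.abs_eq one)
      then show ?thesis using nrm True by (simp add: cinner_self)
    qed (simp add: orth cinner_zpow_zpow)
    moreover have "cinner w (L2_mult (zpow n) w) = (\<integral>z. W z * cnj (z powi n * W z) \<partial>circle_measure)"
      using W sq by (simp add: zpow.abs_eq L2_mult.abs_eq cinner_L2.abs_eq square_integrable_powi)
    moreover have "cinner (zpow 0) (zpow n) = (\<integral>z. 1 * cnj (z powi n) \<partial>circle_measure)"
      by (simp add: zpow.abs_eq cinner_L2.abs_eq one square_integrable_powi)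
    ultimately have "(\<integral>z. W z * cnj (z powi n * W z) - 1 * cnj (z powi n) \<partial>circle_measure) = 0"
      using Bochner_Integration.integral_diff[OF iW i1, of n n] by simp
    then show "(\<integral>z. (W z * cnj (W z) - 1) * cnj (z powi n) \<partial>circle_measure) = 0"
      by (simp add: algebra_simps)
  qed
  then have "AE z in circle_measure. W z * cnj (W z) - 1 = 0" by (rule fourier_null_AE_zero)
  then have "AE z in circle_measure. cmod (W z) = 1"
  proof eventually_elim
    case (elim z)
    then have "complex_of_real ((cmod (W z))\<^sup>2) = complex_of_real 1"
      unfolding complex_norm_square by simp
    then have "(cmod (W z))\<^sup>2 = 1" by (simp only: of_real_eq_iff)
    then show ?case using norm_ge_zero[of "W z"] by (auto simp: power2_eq_1_iff simp del: norm_ge_zero)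
  qed
  then show ?thesis using W by (simp add: unimodular.abs_eq)
qed

section \<open>Hardy spaces and Beurling's theorem\<close>

lemma hardy2_iff: "f \<in> hardy2 \<longleftrightarrow> (\<forall>n<0. cinner f (zpow n) = 0)"
  by (simp add: hardy2_def fourier_coeff_eq_cinner)

text \<open>In this form, closedness and linearity come from the general facts on orthogonal
  complements.\<close>

lemma hardy2_eq_orth_diff: "hardy2 = UNIV \<ominus> zpow ` {..<0}"
  by (auto simp: hardy2_iff orth_diff_def)

lemma csubspace_hardy2: "csubspace hardy2"
  unfolding hardy2_eq_orth_diff by (intro csubspace_orth_diff csubspace_UNIV)

lemma closed_hardy2: "closed hardy2"
  unfolding hardy2_eq_orth_diff by (intro closed_orth_diff closed_UNIV)

lemma zpow_in_hardy2: "0 \<le> n \<Longrightarrow> zpow n \<in> hardy2"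
  by (auto simp: hardy2_iff intro: cinner_zpow_zpow)

lemma zpow_mult_hardy2: "f \<in> hardy2 \<Longrightarrow> 0 \<le> n \<Longrightarrow> L2_mult (zpow n) f \<in> hardy2"
  by (auto simp: hardy2_iff cinner_zpow_mult zpow_mult)

text \<open>An element of H^2 orthogonal to M \<inter> H^2 is orthogonal to z^n for n \<ge> 0 by
  hypothesis and for n < 0 by membership in H^2, hence is 0.\<close>

lemma hardy2_subset_closed_csubspace:
  assumes M: "csubspace M" "closed M" and z: "\<And>n. 0 \<le> n \<Longrightarrow> zpow n \<in> M"
  shows "hardy2 \<subseteq> M"
proof -
  have "hardy2 \<ominus> (M \<inter> hardy2) \<subseteq> {0}"
  proof
    fix f assume f: "f \<in> hardy2 \<ominus> (M \<inter> hardy2)"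
    have "cinner f (zpow n) = 0" for n
    proof (cases "n < 0")
      case True
      then show ?thesis using f by (auto simp: orth_diff_def hardy2_iff)
    next
      case False
      then show ?thesis using f z[of n] zpow_in_hardy2[of n] by (auto simp: orth_diff_def)
    qed
    then show "f \<in> {0}" using eq_zero_if_orth_zpow by simp
  qed
  moreover have "csubspace (M \<inter> hardy2)"
    using M(1) csubspace_hardy2 by (simp add: csubspace_def)
  moreover have "complete (M \<inter> hardy2)"
    by (intro closed_imp_complete_L2 closed_Int M(2) closed_hardy2)
  ultimately have "M \<inter> hardy2 = hardy2"
    by (intro eq_if_orth_diff_trivial csubspace_hardy2) auto
  then show ?thesis by blast
qed

section \<open>Multipliers on Hardy spaces\<close>

lemma csubspace_vimage_L2_mult:
  assumes "essentially_bounded a" "csubspace M"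
  shows "csubspace {f. L2_mult a f \<in> M}"
  using assms(2) by (simp add: csubspace_def L2_mult_add_right L2_mult_scaleC_right assms(1))

lemma closed_vimage_L2_mult:
  assumes "essentially_bounded a" "closed M"
  shows "closed {f. L2_mult a f \<in> M}"
  using continuous_closed_vimage[OF assms(2), of "L2_mult a"] continuous_on_L2_mult[OF assms(1), of UNIV]
  by (simp add: vimage_def continuous_on_eq_continuous_at)

text \<open>The f with a f in M form a closed subspace, so only the powers of z need checking. This
  gives both H^\<infinity> H^2 \<subseteq> H^2 and, in Beurling's theorem, w H^2 \<subseteq>
  M.\<close>

lemma L2_mult_hardy2_subset:
  assumes a: "essentially_bounded a" and M: "csubspace M" "closed M"
    and z: "\<And>n. 0 \<le> n \<Longrightarrow> L2_mult (zpow n) a \<in> M" and f: "f \<in> hardy2"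
  shows "L2_mult a f \<in> M"
proof -
  have "hardy2 \<subseteq> {f. L2_mult a f \<in> M}"
    using z L2_mult_commute[of a]
    by (intro hardy2_subset_closed_csubspace csubspace_vimage_L2_mult closed_vimage_L2_mult a M) auto
  then show ?thesis using f by blast
qed

lemma hardy_inf_mult_hardy2: "a \<in> hardy_inf \<Longrightarrow> f \<in> hardy2 \<Longrightarrow> L2_mult a f \<in> hardy2"
  by (rule L2_mult_hardy2_subset)
    (auto simp: hardy_inf_def csubspace_hardy2 closed_hardy2 intro: zpow_mult_hardy2)

lemma hardy_inf_mult: "a \<in> hardy_inf \<Longrightarrow> b \<in> hardy_inf \<Longrightarrow> L2_mult a b \<in> hardy_inf"
  using hardy_inf_mult_hardy2[of a b] essentially_bounded_mult[of a b] by (simp add: hardy_inf_def)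

lemma inner_function_unimodular: "inner_function w \<Longrightarrow> unimodular w"
  by (simp add: inner_function_def)

lemma inner_function_hardy_inf: "inner_function w \<Longrightarrow> w \<in> hardy_inf"
  by (simp add: inner_function_def hardy_inf_def unimodular_essentially_bounded)

lemma inner_function_mult: "inner_function v \<Longrightarrow> inner_function w \<Longrightarrow> inner_function (L2_mult v w)"
  using hardy_inf_mult_hardy2[OF inner_function_hardy_inf, of v w]
  by (simp add: inner_function_def unimodular_mult_iff)

lemma csubspace_L2_mult_image:
  assumes "essentially_bounded a" "csubspace M"
  shows "csubspace (L2_mult a ` M)"
  by (rule csubspace_image[OF assms(2) clinear_on_L2_mult[OF assms(1)]])

text \<open>Images under isometries are complete, so the subspaces \<Theta> H^2, z M and w H^2 admit
  orthogonal projections.\<close>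

lemma complete_unimodular_mult_image:
  assumes w: "unimodular w" and M: "closed M"
  shows "complete (L2_mult w ` M)"
proof (rule complete_isometric_image)
  have b: "essentially_bounded w" by (rule unimodular_essentially_bounded[OF w])
  show "complete M" by (rule closed_imp_complete_L2[OF M])
  show "continuous_on M (L2_mult w)" by (rule continuous_on_L2_mult[OF b])
  show "dist f g \<le> 1 * dist (L2_mult w f) (L2_mult w g)" for f g
    by (simp add: dist_norm norm_unimodular_mult[OF w] flip: L2_mult_diff_right[OF b])
qed simp

section \<open>Shift-invariant subspaces\<close>

text \<open>The generator w is a unit vector in M orthogonal to z M. It is orthogonal to z^n w for
  all n > 0, hence for all n \<noteq> 0, which makes it unimodular.\<close>

theorem Beurling:
  assumes M: "csubspace M" "closed M" "M \<subseteq> hardy2" and nz: "v \<in> M" "v \<noteq> 0"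
    and shift: "\<And>f. f \<in> M \<Longrightarrow> L2_mult (zpow 1) f \<in> M"
  obtains w where "inner_function w" "M = L2_mult w ` hardy2"
proof -
  have shifts: "L2_mult (zpow (int n)) f \<in> M" if "f \<in> M" for f n
  proof (induction n)
    case (Suc n)
    then show ?case using shift by (metis zpow_mult_mult of_nat_Suc)
  qed (simp add: that)
  define Z where "Z = L2_mult (zpow 1) ` M"
  have ZM: "Z \<subseteq> M" using shift by (auto simp: Z_def)
  have Z: "csubspace Z" "complete Z"
    unfolding Z_def
    by (intro csubspace_L2_mult_image complete_unimodular_mult_image unimodular_zpow zpow_bounded M)+
  \<comment> \<open>If z M = M, elements of M could be divided by z indefinitely without leaving
    H^2, so all their Fourier coefficients would vanish.\<close>
  have "Z \<noteq> M"
  proof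
    assume ZeqM: "Z = M"
    have div: "\<exists>g\<in>M. f = L2_mult (zpow (int n)) g" if "f \<in> M" for f n
    proof (induction n)
      case 0
      show ?case using that by (intro bexI[of _ f]) auto
    next
      case (Suc n)
      then obtain g where g: "g \<in> M" "f = L2_mult (zpow (int n)) g" by blast
      then obtain h where h: "h \<in> M" "g = L2_mult (zpow 1) h" using ZeqM by (auto simp: Z_def)
      have "f = L2_mult (zpow (int (Suc n))) h"
        unfolding g(2) h(2) zpow_mult_mult by (simp add: add.commute)
      then show ?case using h(1) by blast
    qed
    have "cinner v (zpow n) = 0" for n
    proof -
      \<comment> \<open>The exponent is max 0 (n + 1): the coefficient of index n of v is then one
        of g with negative index.\<close>
      obtain g where "g \<in> M" "v = L2_mult (zpow (int (nat (n + 1)))) g" using div[OF nz(1)] by blast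
      then show ?thesis
        using M(3) by (auto simp: cinner_zpow_mult zpow_mult hardy2_iff)
    qed
    then show False using nz(2) eq_zero_if_orth_zpow by blast
  qed
  then have "\<not> M \<ominus> Z \<subseteq> {0}"
    using eq_if_orth_diff_trivial[OF Z ZM M(1)] by blast
  then obtain u where u: "u \<in> M" "\<And>g. g \<in> Z \<Longrightarrow> cinner u g = 0" "u \<noteq> 0"
    by (auto simp: orth_diff_def)
  define w where "w = complex_of_real (1 / norm u) *\<^sub>C u"
  have wM: "w \<in> M" unfolding w_def by (intro csubspaceD(3) M(1) u(1))
  have wZ: "cinner w g = 0" if "g \<in> Z" for g
    using u(2)[OF that] by (simp add: w_def cinner_scaleC_left)
  have "norm w = 1" using u(3) by (simp only: w_def scaleC_of_real) simp
  have zZ: "L2_mult (zpow n) f \<in> Z" if "0 < n" "f \<in> M" for n f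
  proof -
    have "L2_mult (zpow n) f = L2_mult (zpow 1) (L2_mult (zpow (int (nat (n - 1)))) f)"
      using that(1) by (simp add: zpow_mult_mult)
    then show ?thesis
      unfolding Z_def by (rule image_eqI) (rule shifts[OF that(2)])
  qed
  have w: "unimodular w"
  proof (rule unimodular_if_orth_zpow_mult)
    fix n :: int assume "n \<noteq> 0"
    show "cinner w (L2_mult (zpow n) w) = 0"
    proof (cases "0 < n")
      case True
      then show ?thesis by (intro wZ zZ wM)
    next
      case False
      \<comment> \<open>Negative n reduces to positive n, since the coefficients of the real
        function |w|^2 are conjugate symmetric.\<close>
      have "cinner w (L2_mult (zpow n) w) = cnj (cinner w (L2_mult (zpow (- n)) w))"
        using cinner_zpow_mult[of n w w] cinner_commute[of w] by metis
      also have "cinner w (L2_mult (zpow (- n)) w) = 0"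
        using False \<open>n \<noteq> 0\<close> by (intro wZ zZ wM) auto
      finally show ?thesis by simp
    qed
  qed (rule \<open>norm w = 1\<close>)
  then have b: "essentially_bounded w" by (rule unimodular_essentially_bounded)
  have "inner_function w" using w wM M(3) by (auto simp: inner_function_def)
  moreover have "L2_mult w ` hardy2 = M"
  proof (rule eq_if_orth_diff_trivial[OF _ _ _ M(1)])
    show "csubspace (L2_mult w ` hardy2)" "complete (L2_mult w ` hardy2)"
      by (intro csubspace_L2_mult_image complete_unimodular_mult_image b w csubspace_hardy2 closed_hardy2)+
    show "L2_mult w ` hardy2 \<subseteq> M"
    proof
      fix f assume "f \<in> L2_mult w ` hardy2"
      then obtain g where g: "g \<in> hardy2" "f = L2_mult w g" by blast
      have "L2_mult (zpow n) w \<in> M" if "0 \<le> n" for n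
        using shifts[OF wM, of "nat n"] that by simp
      then show "f \<in> M" unfolding g(2) by (rule L2_mult_hardy2_subset[OF b M(1,2) _ g(1)])
    qed
    show "M \<ominus> L2_mult w ` hardy2 \<subseteq> {0}"
    proof
      fix f assume "f \<in> M \<ominus> L2_mult w ` hardy2"
      then have f: "f \<in> M" "\<And>g. g \<in> hardy2 \<Longrightarrow> cinner f (L2_mult w g) = 0"
        by (auto simp: orth_diff_def)
      \<comment> \<open>For n \<ge> 0 this is orthogonality of f to w H^2. For n < 0 the power moves
        to the other side: z^(-n) f lies in z M, to which w is orthogonal.\<close>
      have "cinner f (L2_mult (zpow n) w) = 0" for n
      proof (cases "0 \<le> n")
        case True
        then show ?thesis using f(2)[OF zpow_in_hardy2] by (subst L2_mult_commute)
      next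
        case False
        have "cinner w (L2_mult (zpow (- n)) f) = 0"
          using False f(1) by (intro wZ zZ) auto
        then show ?thesis
          using cinner_zpow_mult[of n w f] cinner_eq_0_commute by metis
      qed
      then show "f \<in> {0}" using eq_zero_if_orth_zpow_mult_unimodular[OF w] by simp
    qed
  qed
  ultimately show ?thesis using that by blast
qed

section \<open>Model spaces\<close>

lemma csubspace_model_space: "csubspace (model_space \<Theta>)"
  unfolding model_space_def by (rule csubspace_orth_diff[OF csubspace_hardy2])

lemma complete_model_space: "complete (model_space \<Theta>)"
  unfolding model_space_def by (intro closed_imp_complete_L2 closed_orth_diff closed_hardy2)

lemma model_space_iff:
  "f \<in> model_space \<Theta> \<longleftrightarrow> f \<in> hardy2 \<and> (\<forall>h\<in>hardy2. cinner f (L2_mult \<Theta> h) = 0)"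
  by (auto simp: model_space_def orth_diff_def)

lemmas proj_model_space_in = orth_proj_in[OF csubspace_model_space complete_model_space]

text \<open>Subtracting from f its projection onto the complete subspace \<Theta> H^2 gives its
  projection onto K_\<Theta>, so H^2 is the orthogonal sum of K_\<Theta> and \<Theta> H^2.\<close>

lemma diff_proj_model_space:
  assumes \<Theta>: "inner_function \<Theta>" and f: "f \<in> hardy2"
  shows "f - orth_proj (model_space \<Theta>) f \<in> L2_mult \<Theta> ` hardy2"
proof -
  define I where "I = L2_mult \<Theta> ` hardy2"
  have u: "unimodular \<Theta>" by (rule inner_function_unimodular[OF \<Theta>])
  have I: "csubspace I" "complete I"
    unfolding I_def
    by (intro csubspace_L2_mult_image complete_unimodular_mult_image csubspace_hardy2 closed_hardy2
        u unimodular_essentially_bounded)+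
  have IH: "I \<subseteq> hardy2"
    using hardy_inf_mult_hardy2[OF inner_function_hardy_inf[OF \<Theta>]] by (auto simp: I_def)
  define g where "g = orth_proj I f"
  have g: "g \<in> I" "\<And>h. h \<in> I \<Longrightarrow> cinner (f - g) h = 0"
    unfolding g_def using orth_proj[OF I] by blast+
  have "orth_proj (model_space \<Theta>) f = f - g"
  proof (rule orth_proj_eqI[OF csubspace_model_space])
    show "f - g \<in> model_space \<Theta>"
      using g IH f csubspaceD(5)[OF csubspace_hardy2] by (auto simp: model_space_iff I_def)
    show "cinner (f - (f - g)) h = 0" if "h \<in> model_space \<Theta>" for h
      using that g(1) by (auto simp: model_space_iff I_def cinner_eq_0_commute[of g])
  qed
  then show ?thesis using g(1) by (simp add: I_def)
qed

lemma proj_model_space_eqI: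
  assumes "g \<in> model_space \<Theta>" "h \<in> hardy2" "f = g + L2_mult \<Theta> h"
  shows "orth_proj (model_space \<Theta>) f = g"
  using assms
  by (intro orth_proj_eqI[OF csubspace_model_space])
    (auto simp: model_space_iff cinner_eq_0_commute[of "L2_mult \<Theta> h"])

lemma unimodular_nonzero:
  assumes "unimodular a" shows "a \<noteq> 0"
proof
  assume "a = 0"
  then have "AE z in circle_measure. (0::real) = 1"
    using assms by (simp add: zero_L2.abs_eq unimodular.abs_eq square_integrable_zero)
  then show False
    using emeasure_circle_measure_UNIV by (simp add: AE_iff_measurable[OF _ refl])
qed

section \<open>Nilpotent truncated Toeplitz operators\<close>

lemma TTO_in_model_space: "TTO \<Theta> \<phi> f \<in> model_space \<Theta>"
  unfolding TTO_def by (rule proj_model_space_in)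

text \<open>As \<phi> is analytic, \<phi> f stays in H^2 and the projection only removes a multiple
  of \<Theta>. Operator identities thus become equations modulo \<Theta> H^2.\<close>

lemma TTO_decomp:
  assumes \<Theta>: "inner_function \<Theta>" and \<phi>: "\<phi> \<in> hardy_inf" and f: "f \<in> hardy2"
  obtains h where "h \<in> hardy2" "L2_mult \<phi> f = TTO \<Theta> \<phi> f + L2_mult \<Theta> h"
proof -
  obtain h where "h \<in> hardy2" "L2_mult \<phi> f - TTO \<Theta> \<phi> f = L2_mult \<Theta> h"
    using diff_proj_model_space[OF \<Theta> hardy_inf_mult_hardy2[OF \<phi> f]] unfolding TTO_def by blast
  then show ?thesis by (intro that[of h]) (auto simp: diff_eq_eq add.commute)
qed

text \<open>For bounded \<phi> the formula \<open>TTO\<close> serves as its own bounded extension;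
  the norm bound is Pythagoras applied to the decomposition of \<phi> f.\<close>

lemma bounded_TTO_hardy_inf:
  assumes \<Theta>: "inner_function \<Theta>" and \<phi>: "\<phi> \<in> hardy_inf"
  shows "bounded_TTO \<Theta> \<phi> (TTO \<Theta> \<phi>)"
proof -
  have b: "essentially_bounded \<phi>" "essentially_bounded \<Theta>"
    using \<phi> inner_function_hardy_inf[OF \<Theta>] by (auto simp: hardy_inf_def)
  note sub = csubspaceD[OF csubspace_hardy2] csubspaceD[OF csubspace_model_space]
  have eqI: "TTO \<Theta> \<phi> f = g"
    if "g \<in> model_space \<Theta>" "h \<in> hardy2" "L2_mult \<phi> f = g + L2_mult \<Theta> h" for f g h
    unfolding TTO_def by (rule proj_model_space_eqI[OF that])
  have mh: "f \<in> hardy2" if "f \<in> model_space \<Theta>" for f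
    using that by (simp add: model_space_iff)
  have "clinear_on (model_space \<Theta>) (TTO \<Theta> \<phi>)"
    unfolding clinear_on_def
  proof (intro conjI ballI allI)
    fix f g assume fg: "f \<in> model_space \<Theta>" "g \<in> model_space \<Theta>"
    obtain h where h: "h \<in> hardy2" "L2_mult \<phi> f = TTO \<Theta> \<phi> f + L2_mult \<Theta> h"
      using TTO_decomp[OF \<Theta> \<phi> mh[OF fg(1)]] .
    obtain k where k: "k \<in> hardy2" "L2_mult \<phi> g = TTO \<Theta> \<phi> g + L2_mult \<Theta> k"
      using TTO_decomp[OF \<Theta> \<phi> mh[OF fg(2)]] .
    show "TTO \<Theta> \<phi> (f + g) = TTO \<Theta> \<phi> f + TTO \<Theta> \<phi> g"
      by (rule eqI[of _ "h + k"]) (auto intro: sub TTO_in_model_space h k simp: L2_mult_add_right b h k)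
  next
    fix c f assume f: "f \<in> model_space \<Theta>"
    obtain h where h: "h \<in> hardy2" "L2_mult \<phi> f = TTO \<Theta> \<phi> f + L2_mult \<Theta> h"
      using TTO_decomp[OF \<Theta> \<phi> mh[OF f]] .
    show "TTO \<Theta> \<phi> (c *\<^sub>C f) = c *\<^sub>C TTO \<Theta> \<phi> f"
      by (rule eqI[of _ "c *\<^sub>C h"])
        (auto intro: sub TTO_in_model_space h simp: L2_mult_scaleC_right b h scaleC_add_right)
  qed
  moreover have "\<exists>C. \<forall>f\<in>model_space \<Theta>. norm (TTO \<Theta> \<phi> f) \<le> C * norm f"
  proof -
    obtain C where C: "\<forall>f. norm (L2_mult \<phi> f) \<le> C * norm f"
      using b(1) by (rule L2_mult_bounded)
    have "norm (TTO \<Theta> \<phi> f) \<le> norm (L2_mult \<phi> f)" if f: "f \<in> model_space \<Theta>" for f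
    proof -
      obtain h where h: "h \<in> hardy2" "L2_mult \<phi> f = TTO \<Theta> \<phi> f + L2_mult \<Theta> h"
        using TTO_decomp[OF \<Theta> \<phi> mh[OF f]] .
      have "cinner (TTO \<Theta> \<phi> f) (L2_mult \<Theta> h) = 0"
        using TTO_in_model_space[of \<Theta> \<phi> f] h(1) by (simp add: model_space_iff)
      then have "inner (TTO \<Theta> \<phi> f) (L2_mult \<Theta> h) = 0"
        by (simp flip: Re_cinner)
      then have "(norm (L2_mult \<phi> f))\<^sup>2 = (norm (TTO \<Theta> \<phi> f))\<^sup>2 + (norm (L2_mult \<Theta> h))\<^sup>2"
        unfolding h(2) by (simp add: power2_norm_eq_inner inner_add_left inner_add_right inner_commute)
      then have "(norm (TTO \<Theta> \<phi> f))\<^sup>2 \<le> (norm (L2_mult \<phi> f))\<^sup>2" by simp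
      then show ?thesis by (rule power2_le_imp_le) simp
    qed
    then show ?thesis using C order_trans by blast
  qed
  ultimately show ?thesis
    using TTO_in_model_space by (auto simp: bounded_TTO_def bounded_operator_on_def)
qed

theorem theorem5p3:
  fixes \<Theta> \<phi> :: L2 and k :: enat and E :: "'e::complex_inner set"
  assumes "inner_function \<Theta>"
    and "\<phi> \<in> hardy_inf"
    and "\<forall>f\<in>model_space \<Theta>. TTO \<Theta> \<phi> (TTO \<Theta> \<phi> f) = 0"
    and "has_hilbert_dim (model_space \<Theta> \<ominus> ker_on (model_space \<Theta>) (TTO \<Theta> \<phi>)) k"
    and "csubspace E" and "complete E" and "has_hilbert_dim E k"
  shows "unitarily_equivalent_to_TTO (model_space \<Theta> \<times> E) (map_prod (TTO \<Theta> \<phi>) (\<lambda>_. 0))"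
proof -
  note \<Theta> = assms(1) and \<phi> = assms(2)
  let ?H = hardy2 and ?K = model_space and ?A = "TTO \<Theta> \<phi>"
  have \<Theta>u: "unimodular \<Theta>" and \<Theta>b: "essentially_bounded \<Theta>"
    using \<Theta> by (auto simp: inner_function_def unimodular_essentially_bounded)
  have \<phi>b: "essentially_bounded \<phi>" and \<phi>H: "\<phi> \<in> ?H" using \<phi> by (auto simp: hardy_inf_def)
  have \<Theta>H: "L2_mult \<Theta> h \<in> ?H" if "h \<in> ?H" for h
    by (rule hardy_inf_mult_hardy2[OF inner_function_hardy_inf[OF \<Theta>] that])
  define I where "I = L2_mult \<Theta> ` ?H"
  have I: "csubspace I" "complete I"
    unfolding I_def
    by (intro csubspace_L2_mult_image complete_unimodular_mult_image \<Theta>b \<Theta>u csubspace_hardy2 closed_hardy2)+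
  define M where "M = ?H \<inter> {f. L2_mult \<phi> f \<in> I}"
  have M: "csubspace M" "closed M"
  proof -
    have "csubspace {f. L2_mult \<phi> f \<in> I}" by (rule csubspace_vimage_L2_mult[OF \<phi>b I(1)])
    then show "csubspace M" using csubspace_hardy2 by (auto simp: csubspace_def M_def)
    show "closed M"
      unfolding M_def
      by (intro closed_Int closed_hardy2 closed_vimage_L2_mult \<phi>b complete_imp_closed I(2))
  qed
  have \<Theta>M: "\<Theta> \<in> M"
    using \<Theta> \<phi>H by (auto simp: M_def I_def inner_function_def L2_mult_commute[of \<phi> \<Theta>])
  have "\<Theta> \<noteq> 0" by (rule unimodular_nonzero[OF \<Theta>u])
  obtain w where w: "inner_function w" and Mw: "M = L2_mult w ` ?H"
  proof (rule Beurling[OF M _ \<Theta>M \<open>\<Theta> \<noteq> 0\<close>])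
    show "M \<subseteq> ?H" by (auto simp: M_def)
    fix f assume f: "f \<in> M"
    then obtain h where h: "h \<in> ?H" "L2_mult \<phi> f = L2_mult \<Theta> h" by (auto simp: M_def I_def)
    have "L2_mult \<phi> (L2_mult (zpow 1) f) = L2_mult \<Theta> (L2_mult (zpow 1) h)"
      using h(2) L2_mult_left_commute[OF zpow_bounded] \<phi>b \<Theta>b by metis
    moreover have "L2_mult (zpow 1) h \<in> ?H" "L2_mult (zpow 1) f \<in> ?H"
      using f h(1) by (auto simp: M_def intro: zpow_mult_hardy2)
    ultimately show "L2_mult (zpow 1) f \<in> M"
      by (simp add: M_def I_def)
  qed
  have wu: "unimodular w" and wb: "essentially_bounded w"
    using w by (auto simp: inner_function_def unimodular_essentially_bounded)
  have winf: "w \<in> hardy_inf" by (rule inner_function_hardy_inf[OF w])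
  have wH: "L2_mult w h \<in> ?H" if "h \<in> ?H" for h by (rule hardy_inf_mult_hardy2[OF winf that])
  have \<Theta>h_M: "L2_mult \<Theta> h \<in> M" if "h \<in> ?H" for h
    using that hardy_inf_mult_hardy2[OF \<phi> that] \<Theta>H
    by (auto simp: M_def I_def L2_mult_left_commute[OF \<phi>b \<Theta>b])
  \<comment> \<open>The inclusion \<Theta> H^2 \<subseteq> w H^2 says that w divides \<Theta>;
    orthogonal complements reverse it.\<close>
  have KwI: "?K w \<subseteq> ?K \<Theta>"
  proof
    fix f assume f: "f \<in> ?K w"
    have "cinner f (L2_mult \<Theta> h) = 0" if "h \<in> ?H" for h
      using \<Theta>h_M[OF that] f unfolding Mw by (auto simp: model_space_iff)
    then show "f \<in> ?K \<Theta>" using f by (simp add: model_space_iff)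
  qed
  have KH: "f \<in> ?H" if "f \<in> ?K v" for f v using that by (simp add: model_space_iff)
  have Kw_M: "cinner f g = 0" "cinner g f = 0" if "f \<in> ?K w" "g \<in> M" for f g
    using that unfolding Mw by (auto simp: model_space_iff cinner_eq_0_commute[of _ f])
  have A_M: "?A f = 0 \<longleftrightarrow> f \<in> M" if f: "f \<in> ?K \<Theta>" for f
  proof
    assume "?A f = 0"
    then show "f \<in> M"
      using TTO_decomp[OF \<Theta> \<phi> KH[OF f]] KH[OF f] by (auto simp: M_def I_def)
  next
    assume "f \<in> M"
    then obtain h where "h \<in> ?H" "L2_mult \<phi> f = 0 + L2_mult \<Theta> h" by (auto simp: M_def I_def)
    then show "?A f = 0"
      unfolding TTO_def by (intro proj_model_space_eqI csubspaceD(1) csubspace_model_space)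
  qed
  have ker: "?K \<Theta> \<ominus> ker_on (?K \<Theta>) ?A = ?K w"
  proof
    show "?K w \<subseteq> ?K \<Theta> \<ominus> ker_on (?K \<Theta>) ?A"
      using KwI Kw_M(1) A_M by (auto simp: orth_diff_def ker_on_def)
    show "?K \<Theta> \<ominus> ker_on (?K \<Theta>) ?A \<subseteq> ?K w"
    proof
      fix f assume f: "f \<in> ?K \<Theta> \<ominus> ker_on (?K \<Theta>) ?A"
      \<comment> \<open>Write w h = g + \<Theta> r with g in K_\<Theta>. Both w h and \<Theta> r lie
        in M, hence so does g, which is thus in ker A. So f is orthogonal to both summands.\<close>
      have "cinner f (L2_mult w h) = 0" if h: "h \<in> ?H" for h
      proof -
        define g where "g = orth_proj (?K \<Theta>) (L2_mult w h)"
        obtain r where r: "r \<in> ?H" "L2_mult w h - g = L2_mult \<Theta> r"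
          using diff_proj_model_space[OF \<Theta> wH[OF h]] unfolding g_def by blast
        have gK: "g \<in> ?K \<Theta>" unfolding g_def by (rule proj_model_space_in)
        have "g = L2_mult w h - L2_mult \<Theta> r" using r(2) by (simp add: algebra_simps)
        moreover have "L2_mult w h \<in> M" using h by (simp add: Mw)
        ultimately have "g \<in> M" using csubspaceD(5)[OF M(1)] \<Theta>h_M[OF r(1)] by blast
        then have "cinner f g = 0" using f gK A_M by (auto simp: orth_diff_def ker_on_def)
        moreover have "cinner f (L2_mult \<Theta> r) = 0"
          using f r(1) by (auto simp: orth_diff_def model_space_iff)
        moreover have "L2_mult w h = g + L2_mult \<Theta> r" using r(2) by (simp add: algebra_simps)
        ultimately show ?thesis by (simp add: cinner_add_right)
      qed
      then show "f \<in> ?K w" using f by (auto simp: model_space_iff orth_diff_def)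
    qed
  qed
  obtain V where V: "clinear_on E V" "V ` E = ?K w"
    and Viso: "\<And>x y. x \<in> E \<Longrightarrow> y \<in> E \<Longrightarrow> cinner (V x) (V y) = cinner x y"
    using unitary_of_hilbert_dim[OF assms(5,6) csubspace_model_space complete_model_space assms(7)
        assms(4)[unfolded ker]] by blast
  have VK: "V e \<in> ?K w" if "e \<in> E" for e using V(2) that by blast
  define P where "P = orth_proj (?K w)"
  have P_eqI: "P f = g" if "g \<in> ?K w" "f - g \<in> M" for f g
  proof -
    obtain h where "h \<in> ?H" "f - g = L2_mult w h" using \<open>f - g \<in> M\<close> Mw by blast
    then show ?thesis
      unfolding P_def by (intro proj_model_space_eqI[OF that(1)]) (auto simp: algebra_simps)
  qed
  have PK: "P f \<in> ?K w" for f unfolding P_def by (rule proj_model_space_in)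
  have PM: "f - P f \<in> M" if "f \<in> ?H" for f
    unfolding P_def Mw by (rule diff_proj_model_space[OF w that])
  define \<Theta>' where "\<Theta>' = L2_mult w \<Theta>"
  define \<phi>' where "\<phi>' = L2_mult w \<phi>"
  have \<Theta>': "inner_function \<Theta>'" unfolding \<Theta>'_def by (rule inner_function_mult[OF w \<Theta>])
  have \<phi>': "\<phi>' \<in> hardy_inf" unfolding \<phi>'_def by (rule hardy_inf_mult[OF winf \<phi>])
  have \<Theta>'h: "L2_mult \<Theta>' h = L2_mult w (L2_mult \<Theta> h)" for h
    unfolding \<Theta>'_def by (rule L2_mult_assoc[OF wb \<Theta>b])
  have \<phi>'h: "L2_mult \<phi>' h = L2_mult w (L2_mult \<phi> h)" for h
    unfolding \<phi>'_def by (rule L2_mult_assoc[OF wb \<phi>b])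
  have wK: "L2_mult w f \<in> ?K \<Theta>'" if "f \<in> ?K \<Theta>" for f
    using that by (auto simp: model_space_iff \<Theta>'h cinner_unimodular_mult[OF wu] intro: wH)
  have KwK': "f \<in> ?K \<Theta>'" if "f \<in> ?K w" for f
    using that by (auto simp: model_space_iff \<Theta>'h intro: \<Theta>H)
  have K'sub: "csubspace (?K \<Theta>')" and KTsub: "csubspace (?K \<Theta>)" by (rule csubspace_model_space)+
  \<comment> \<open>The part P f stays, since the symbol \<phi>' already maps it to w (A f). The
    part f - P f lies in ker A and is moved into w K_\<Theta>, where the new operator vanishes. The
    space w K_w, which no f reaches, receives E.\<close>
  define U where "U = (\<lambda>(f, e). P f + L2_mult w (f - P f) + L2_mult w (V e))"
  have U: "U (f, e) = P f + L2_mult w (f - P f) + L2_mult w (V e)" for f e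
    by (simp add: U_def)
  have dK: "f - P f \<in> ?K \<Theta>" if "f \<in> ?K \<Theta>" for f
    using that PK KwI by (blast intro: csubspaceD(5)[OF KTsub])
  have V0: "V 0 = 0" and Vadd: "x \<in> E \<Longrightarrow> y \<in> E \<Longrightarrow> V (x + y) = V x + V y"
    and Vscale: "x \<in> E \<Longrightarrow> V (c *\<^sub>C x) = c *\<^sub>C V x" for x y c
    by (rule clinear_onD[OF assms(5) V(1)]; assumption)+
  have Padd: "P (f + g) = P f + P g" if "f \<in> ?H" "g \<in> ?H" for f g
  proof (rule P_eqI)
    show "P f + P g \<in> ?K w" by (intro csubspaceD(2) csubspace_model_space PK)
    have "f - P f + (g - P g) \<in> M" by (intro csubspaceD(2) M(1) PM that)
    then show "f + g - (P f + P g) \<in> M" by (simp add: algebra_simps)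
  qed
  have scaleC_diff: "c *\<^sub>C (x - y) = c *\<^sub>C x - c *\<^sub>C y" for c and x y :: L2
    using scaleC_add_right[of c "x - y" y] by simp
  have Pscale: "P (c *\<^sub>C f) = c *\<^sub>C P f" if "f \<in> ?H" for c f
  proof (rule P_eqI)
    show "c *\<^sub>C P f \<in> ?K w" by (intro csubspaceD(3) csubspace_model_space PK)
    have "c *\<^sub>C (f - P f) \<in> M" by (intro csubspaceD(3) M(1) PM that)
    then show "c *\<^sub>C f - c *\<^sub>C P f \<in> M" by (simp only: scaleC_diff)
  qed
  have "clinear_on (?K \<Theta> \<times> E) U"
    unfolding clinear_on_def
  proof (intro conjI ballI allI)
    fix p q assume "p \<in> ?K \<Theta> \<times> E" "q \<in> ?K \<Theta> \<times> E"
    then obtain f e g d where *: "p = (f, e)" "q = (g, d)" "f \<in> ?K \<Theta>" "g \<in> ?K \<Theta>" "e \<in> E" "d \<in> E"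
      by blast
    show "U (p + q) = U p + U q"
      using * KH by (simp add: U Padd Vadd L2_mult_add_right[OF wb] L2_mult_diff_right[OF wb])
  next
    fix c p assume "p \<in> ?K \<Theta> \<times> E"
    then obtain f e where *: "p = (f, e)" "f \<in> ?K \<Theta>" "e \<in> E" by blast
    show "U (c *\<^sub>C p) = c *\<^sub>C U p"
      using * KH by (simp add: U scaleC_prod_def Pscale Vscale L2_mult_scaleC_right[OF wb]
          L2_mult_diff_right[OF wb] scaleC_diff scaleC_add_right)
  qed
  moreover have "U ` (?K \<Theta> \<times> E) = ?K \<Theta>'"
  proof
    show "U ` (?K \<Theta> \<times> E) \<subseteq> ?K \<Theta>'"
    proof
      fix g assume "g \<in> U ` (?K \<Theta> \<times> E)"
      then obtain f e where *: "g = U (f, e)" "f \<in> ?K \<Theta>" "e \<in> E" by blast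
      show "g \<in> ?K \<Theta>'"
        unfolding *(1) U using VK[OF *(3)] KwI
        by (intro csubspaceD(2)[OF K'sub] wK dK *(2) KwK' PK) blast
    qed
    show "?K \<Theta>' \<subseteq> U ` (?K \<Theta> \<times> E)"
    proof
      fix F assume F: "F \<in> ?K \<Theta>'"
      obtain g where g: "g \<in> ?H" "F - P F = L2_mult w g"
        using PM[OF KH[OF F]] unfolding Mw by blast
      obtain e where e: "e \<in> E" "V e = P g" using V(2) PK[of g] by (metis imageE)
      \<comment> \<open>The multiple w g of w is split along g = (g - P g) + P g: the first part
        comes from K_\<Theta>, the second from E.\<close>
      define f where "f = P F + (g - P g)"
      have "g - P g \<in> ?K \<Theta>"
        unfolding model_space_iff
      proof (intro conjI ballI)
        show "g - P g \<in> ?H" by (intro csubspaceD(5)[OF csubspace_hardy2] g(1) KH[OF PK])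
        fix h assume h: "h \<in> ?H"
        \<comment> \<open>As w is an isometry, testing g against \<Theta> H^2 amounts to testing w g
          = F - P F against \<Theta>' H^2, and both F and P F lie in K_\<Theta>'.\<close>
        have "cinner g (L2_mult \<Theta> h) = cinner (L2_mult w g) (L2_mult \<Theta>' h)"
          unfolding \<Theta>'h by (rule cinner_unimodular_mult[OF wu, symmetric])
        also have "\<dots> = cinner F (L2_mult \<Theta>' h) - cinner (P F) (L2_mult \<Theta>' h)"
          unfolding g(2)[symmetric] by (rule cinner_diff_left)
        also have "\<dots> = 0" using F KwK'[OF PK[of F]] h by (simp add: model_space_iff)
        finally have "cinner g (L2_mult \<Theta> h) = 0" .
        moreover have "cinner (P g) (L2_mult \<Theta> h) = 0"
          by (rule Kw_M(1)[OF PK \<Theta>h_M[OF h]])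
        ultimately show "cinner (g - P g) (L2_mult \<Theta> h) = 0" by (simp add: cinner_diff_left)
      qed
      then have f: "f \<in> ?K \<Theta>" using PK[of F] KwI csubspaceD(2)[OF KTsub] by (auto simp: f_def)
      have Pf: "P f = P F"
        by (rule P_eqI[OF PK]) (simp add: f_def PM[OF g(1)])
      have "U (f, e) = P F + (L2_mult w (g - P g) + L2_mult w (P g))"
        unfolding U Pf e(2) by (simp add: f_def)
      also have "\<dots> = F" using g(2) by (simp add: L2_mult_diff_right[OF wb] flip: g(2))
      finally show "F \<in> U ` (?K \<Theta> \<times> E)" using f e(1) by (metis SigmaI imageI)
    qed
  qed
  moreover have "\<forall>p\<in>?K \<Theta> \<times> E. \<forall>q\<in>?K \<Theta> \<times> E. cinner (U p) (U q) = cinner p q"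
  proof (intro ballI)
    fix p q assume "p \<in> ?K \<Theta> \<times> E" "q \<in> ?K \<Theta> \<times> E"
    then obtain f e g d where *: "p = (f, e)" "q = (g, d)" "f \<in> ?K \<Theta>" "g \<in> ?K \<Theta>" "e \<in> E" "d \<in> E"
      by blast
    \<comment> \<open>The three terms of U are orthogonal: K_w is orthogonal to all multiples of w,
      and within these the factor w cancels, leaving f - P f in M against V e in K_w.\<close>
    have wM: "L2_mult w h \<in> M" if "h \<in> ?H" for h using that by (simp add: Mw)
    have o1: "cinner (P f) (L2_mult w h) = 0" "cinner (L2_mult w h) (P f) = 0" if "h \<in> ?H" for f h
      using Kw_M[OF PK wM[OF that]] by auto
    have o2: "cinner (f - P f) (V e) = 0" "cinner (V e) (f - P f) = 0" if "f \<in> ?K \<Theta>" "e \<in> E" for f e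
      using Kw_M[OF VK[OF that(2)] PM[OF KH[OF that(1)]]] by auto
    have o3: "cinner (P f) (h - P h) = 0" "cinner (h - P h) (P f) = 0" if "h \<in> ?H" for f h
      using Kw_M[OF PK PM[OF that]] by auto
    have H: "f - P f \<in> ?H" "g - P g \<in> ?H" "V e \<in> ?H" "V d \<in> ?H"
      using KH[OF dK] KH[OF VK] * by auto
    have "cinner (U p) (U q) = cinner (P f) (P g) + cinner (f - P f) (g - P g) + cinner (V e) (V d)"
      unfolding * U cinner_add_left cinner_add_right
      using H o2 * by (simp add: cinner_unimodular_mult[OF wu] o1)
    also have "cinner (V e) (V d) = cinner e d" by (rule Viso[OF *(5,6)])
    also have "cinner (P f) (P g) + cinner (f - P f) (g - P g) = cinner f g"
    proof -
      have "cinner f g = cinner (P f + (f - P f)) (P g + (g - P g))" by simp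
      also have "\<dots> = cinner (P f) (P g) + cinner (f - P f) (g - P g)"
        unfolding cinner_add_left cinner_add_right
        using o3(1)[OF KH[OF *(4)], of f] o3(2)[OF KH[OF *(3)], of g] by simp
      finally show ?thesis by simp
    qed
    finally show "cinner (U p) (U q) = cinner p q" by (simp add: * cinner_prod_def)
  qed
  moreover have "\<forall>p\<in>?K \<Theta> \<times> E. U (map_prod ?A (\<lambda>_. 0) p) = TTO \<Theta>' \<phi>' (U p)"
  proof
    fix p assume "p \<in> ?K \<Theta> \<times> E"
    then obtain f e where *: "p = (f, e)" "f \<in> ?K \<Theta>" "e \<in> E" by blast
    have AK: "?A f \<in> ?K \<Theta>" by (rule TTO_in_model_space)
    \<comment> \<open>Here A^2 = 0 enters: A f has no component in K_w, so U multiplies the whole of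
      it by w.\<close>
    have "?A f \<in> M" using A_M[OF AK] assms(3) *(2) by blast
    then have "P (?A f) = 0"
      by (intro P_eqI csubspaceD(1) csubspace_model_space) simp
    then have lhs: "U (map_prod ?A (\<lambda>_. 0) p) = L2_mult w (?A f)"
      by (simp add: * U V0)
    have phiM: "\<exists>h\<in>?H. L2_mult \<phi> g = L2_mult \<Theta> h" if "g \<in> M" for g
      using that by (auto simp: M_def I_def)
    obtain a where a: "a \<in> ?H" "L2_mult \<phi> f = ?A f + L2_mult \<Theta> a"
      using TTO_decomp[OF \<Theta> \<phi> KH[OF *(2)]] .
    obtain b where b: "b \<in> ?H" "L2_mult \<phi> (f - P f) = L2_mult \<Theta> b"
      using phiM[OF PM[OF KH[OF *(2)]]] by blast
    have "f - P f + V e \<in> ?H" by (intro csubspaceD(2)[OF csubspace_hardy2] KH[OF dK] *(2) KH[OF VK] *(3))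
    then have "L2_mult w (f - P f + V e) \<in> M" by (simp add: Mw)
    then obtain c where c: "c \<in> ?H" "L2_mult \<phi> (L2_mult w (f - P f + V e)) = L2_mult \<Theta> c"
      using phiM by blast
    \<comment> \<open>U p differs from f only by elements of M, which \<phi> sends into \<Theta>
      H^2. So \<phi> (U p) and A f agree modulo \<Theta> H^2, and the factor w turns this into
      agreement modulo \<Theta>' H^2.\<close>
    have "U p = f - (f - P f) + L2_mult w (f - P f + V e)"
      unfolding *(1) U L2_mult_add_right[OF wb] by simp
    then have "L2_mult \<phi> (U p) = L2_mult \<phi> f - L2_mult \<phi> (f - P f) + L2_mult \<phi> (L2_mult w (f - P f + V e))"
      by (simp only: L2_mult_add_right[OF \<phi>b] L2_mult_diff_right[OF \<phi>b])
    also have "\<dots> = ?A f + L2_mult \<Theta> (a - b + c)"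
      unfolding a(2) b(2) c(2) by (simp add: L2_mult_add_right[OF \<Theta>b] L2_mult_diff_right[OF \<Theta>b])
    finally have "L2_mult \<phi>' (U p) = L2_mult w (?A f) + L2_mult \<Theta>' (a - b + c)"
      by (simp only: \<phi>'h \<Theta>'h L2_mult_add_right[OF wb])
    moreover have "a - b + c \<in> ?H"
      by (intro csubspaceD(2,5)[OF csubspace_hardy2] a(1) b(1) c(1))
    ultimately have "TTO \<Theta>' \<phi>' (U p) = L2_mult w (?A f)"
      unfolding TTO_def[of \<Theta>' \<phi>'] by (rule proj_model_space_eqI[OF wK[OF AK], rotated])
    then show "U (map_prod ?A (\<lambda>_. 0) p) = TTO \<Theta>' \<phi>' (U p)" using lhs by simp
  qed
  ultimately have "unitarily_equivalent (?K \<Theta> \<times> E) (map_prod ?A (\<lambda>_. 0)) (?K \<Theta>') (TTO \<Theta>' \<phi>')"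
    unfolding unitarily_equivalent_def by (intro exI[of _ U] conjI)
  then show ?thesis
    unfolding unitarily_equivalent_to_TTO_def using \<Theta>' bounded_TTO_hardy_inf[OF \<Theta>' \<phi>'] by blast
qed

end
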